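(* Let $(F,G):\mathcal{A}\to\mathcal{B}$ be an adjoint pair ($F$ left adjoint to $G$) between bicomplete abelian categories and let $(\varphi,\psi):Pr(\mathcal{A})\to Pr(\mathcal{B})$ be the induced Galois connection. If $k:N\to M$ is any morphism in $\mathcal{B}$, then $\psi(\omega_k)=\omega_{G(k)}$.
   Context: Bicomplete means complete and cocomplete; Hom-classes are sets. A preradical of an abelian category $\mathcal{A}$ is a subobject of the identity functor $1_{\mathcal{A}}$ in the (possibly extended) abelian category $\mathrm{Fun}(\mathcal{A},\mathcal{A})$, i.e. the equivalence class of a monomorphic natural transformation $\tau:T\hookrightarrow 1_{\mathcal{A}}$, two such being equivalent if each factors through the other. $Pr(\mathcal{A})$ is the collection of preradicals, ordered by $\tau\leq\sigma$ iff $\tau$ factors through $\sigma$. With unit $\eta:1_{\mathcal{A}}\to GF$ and counit $\varepsilon:FG\to1_{\mathcal{B}}$, the induced Galois connection is given by $\varphi(\tau)=\mathrm{Im}(\varepsilon\circ F\tau G:FTG\to 1_{\mathcal{B}})$ for $\tau:T\hookrightarrow1_{\mathcal{A}}$, and $\psi(\sigma)=\mathrm{Ker}(\pi_\sigma\circ\eta)$ for $\sigma:S\hookrightarrow 1_{\mathcal{B}}$, where $\pi_\sigma:GF\to\mathrm{Ckr}(G\sigma F)$ is a cokernel of $G\sigma F:GSF\to GF$. Omega preradicals: for objects $N,M$ of a bicomplete abelian category $\mathcal{C}$, $\mathbb{W}_M^N:\mathcal{C}\to\mathcal{C}$ is the functor $L\mapsto M^{\mathrm{Hom}_{\mathcal{C}}(L,N)}$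 (product of copies of $M$ indexed by $\mathrm{Hom}_{\mathcal{C}}(L,N)$, with projections $\pi_f$), the composite of the contravariant functors $\mathrm{Hom}_{\mathcal{C}}(-,N)$ and $M^{-}$. For a morphism $k:N\to M$ in $\mathcal{C}$, $\mathbf{W}_k:1_{\mathcal{C}}\to\mathbb{W}_M^N$ is the natural transformation determined by $\pi_f\circ[\mathbf{W}_k]_L=k\circ f$ for all $L$ and all $f\in\mathrm{Hom}_{\mathcal{C}}(L,N)$. The omega preradical associated to $k$ is $\omega_k:=\mathrm{Ker}(\mathbf{W}_k)$. *)

theory Defs
  imports "HOL-Algebra.Group" "HOL-Library.FuncSet" "HOL-Library.Equipollence"
begin

section \<open>Categories\<close>

record ('o, 'a) cat =
  Obj :: "'o set"
  Arr :: "'a set"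
  Dom :: "'a \<Rightarrow> 'o"
  Cod :: "'a \<Rightarrow> 'o"
  Ident :: "'o \<Rightarrow> 'a"
  Comp :: "'a \<Rightarrow> 'a \<Rightarrow> 'a"  (infixl \<open>\<cdot>\<index>\<close> 70)

definition Hom :: "('o, 'a, 'm) cat_scheme \<Rightarrow> 'o \<Rightarrow> 'o \<Rightarrow> 'a set" where
  "Hom C X Y = {f \<in> Arr C. Dom C f = X \<and> Cod C f = Y}"

locale category =
  fixes C :: "('o, 'a) cat" (structure)
  assumes Dom_Obj: "f \<in> Arr C \<Longrightarrow> Dom C f \<in> Obj C"
    and Cod_Obj: "f \<in> Arr C \<Longrightarrow> Cod C f \<in> Obj C"
    and Ident_Hom: "X \<in> Obj C \<Longrightarrow> Ident C X \<in> Hom C X X"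
    and Comp_Hom: "f \<in> Hom C X Y \<Longrightarrow> g \<in> Hom C Y Z \<Longrightarrow> g \<cdot> f \<in> Hom C X Z"
    and Comp_Ident: "f \<in> Hom C X Y \<Longrightarrow> f \<cdot> Ident C X = f"
    and Ident_Comp: "f \<in> Hom C X Y \<Longrightarrow> Ident C Y \<cdot> f = f"
    and Comp_assoc: "f \<in> Hom C W X \<Longrightarrow> g \<in> Hom C X Y \<Longrightarrow> h \<in> Hom C Y Z \<Longrightarrow>
           (h \<cdot> g) \<cdot> f = h \<cdot> (g \<cdot> f)"

section \<open>Monomorphisms, kernels, subobjects\<close>

definition is_mono :: "('o, 'a) cat \<Rightarrow> 'a \<Rightarrow> bool" where
  "is_mono C m \<longleftrightarrow> m \<in> Arr C \<and>
     (\<forall>X\<in>Obj C. \<forall>f\<in>Hom C X (Dom C m). \<forall>g\<in>Hom C X (Dom C m).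
        m \<cdot>\<^bsub>C\<^esub> f = m \<cdot>\<^bsub>C\<^esub> g \<longrightarrow> f = g)"

definition is_epi :: "('o, 'a) cat \<Rightarrow> 'a \<Rightarrow> bool" where
  "is_epi C e \<longleftrightarrow> e \<in> Arr C \<and>
     (\<forall>Y\<in>Obj C. \<forall>f\<in>Hom C (Cod C e) Y. \<forall>g\<in>Hom C (Cod C e) Y.
        f \<cdot>\<^bsub>C\<^esub> e = g \<cdot>\<^bsub>C\<^esub> e \<longrightarrow> f = g)"

definition is_zero_object :: "('o, 'a) cat \<Rightarrow> 'o \<Rightarrow> bool" where
  "is_zero_object C Z \<longleftrightarrow> Z \<in> Obj C \<and>
     (\<forall>X\<in>Obj C. (\<exists>!f. f \<in> Hom C X Z) \<and> (\<exists>!f. f \<in> Hom C Z X))"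

definition is_zero_arrow :: "('o, 'a) cat \<Rightarrow> 'a \<Rightarrow> bool" where
  "is_zero_arrow C f \<longleftrightarrow> f \<in> Arr C \<and>
     (\<exists>Z p q. is_zero_object C Z \<and> p \<in> Hom C (Dom C f) Z \<and> q \<in> Hom C Z (Cod C f) \<and>
        f = q \<cdot>\<^bsub>C\<^esub> p)"

definition is_kernel :: "('o, 'a) cat \<Rightarrow> 'a \<Rightarrow> 'a \<Rightarrow> bool" where
  "is_kernel C f m \<longleftrightarrow> f \<in> Arr C \<and> m \<in> Arr C \<and> Cod C m = Dom C f \<and>
     is_zero_arrow C (f \<cdot>\<^bsub>C\<^esub> m) \<and>
     (\<forall>h\<in>Arr C. Cod C h = Dom C f \<and> is_zero_arrow C (f \<cdot>\<^bsub>C\<^esub> h) \<longrightarrow>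
        (\<exists>!u. u \<in> Hom C (Dom C h) (Dom C m) \<and> m \<cdot>\<^bsub>C\<^esub> u = h))"

definition is_cokernel :: "('o, 'a) cat \<Rightarrow> 'a \<Rightarrow> 'a \<Rightarrow> bool" where
  "is_cokernel C f e \<longleftrightarrow> f \<in> Arr C \<and> e \<in> Arr C \<and> Dom C e = Cod C f \<and>
     is_zero_arrow C (e \<cdot>\<^bsub>C\<^esub> f) \<and>
     (\<forall>h\<in>Arr C. Dom C h = Cod C f \<and> is_zero_arrow C (h \<cdot>\<^bsub>C\<^esub> f) \<longrightarrow>
        (\<exists>!u. u \<in> Hom C (Cod C e) (Cod C h) \<and> u \<cdot>\<^bsub>C\<^esub> e = h))"

definition factors_through :: "('o, 'a) cat \<Rightarrow> 'a \<Rightarrow> 'a \<Rightarrow> bool" where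
  "factors_through C m n \<longleftrightarrow> (\<exists>u\<in>Hom C (Dom C m) (Dom C n). m = n \<cdot>\<^bsub>C\<^esub> u)"

text \<open>A subobject is the equivalence class (as a set of monomorphisms) of a monomorphism.\<close>

definition subobject_of :: "('o, 'a) cat \<Rightarrow> 'a \<Rightarrow> 'a set" where
  "subobject_of C m = {n. is_mono C n \<and> Cod C n = Cod C m \<and>
     factors_through C n m \<and> factors_through C m n}"

definition subobjects :: "('o, 'a) cat \<Rightarrow> 'o \<Rightarrow> 'a set set" where
  "subobjects C X = {subobject_of C m | m. is_mono C m \<and> Cod C m = X}"

definition Ker :: "('o, 'a) cat \<Rightarrow> 'a \<Rightarrow> 'a set" where
  "Ker C f = subobject_of C (SOME m. is_kernel C f m)"

definition some_cokernel :: "('o, 'a) cat \<Rightarrow> 'a \<Rightarrow> 'a" where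
  "some_cokernel C f = (SOME e. is_cokernel C f e)"

text \<open>Images are only used in abelian (functor) categories, where they are kernels of cokernels.\<close>

definition image_subobject :: "('o, 'a) cat \<Rightarrow> 'a \<Rightarrow> 'a set" where
  "image_subobject C f = Ker C (some_cokernel C f)"

section \<open>Abelian categories\<close>

definition Hom_group ::
  "('o, 'a) cat \<Rightarrow> ('a \<Rightarrow> 'a \<Rightarrow> 'a) \<Rightarrow> ('o \<Rightarrow> 'o \<Rightarrow> 'a) \<Rightarrow> 'o \<Rightarrow> 'o \<Rightarrow> 'a monoid" where
  "Hom_group C pl zr X Y = \<lparr>carrier = Hom C X Y, mult = pl, one = zr X Y\<rparr>"

definition preadditive ::
  "('o, 'a) cat \<Rightarrow> ('a \<Rightarrow> 'a \<Rightarrow> 'a) \<Rightarrow> ('o \<Rightarrow> 'o \<Rightarrow> 'a) \<Rightarrow> bool" where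
  "preadditive C pl zr \<longleftrightarrow> category C \<and>
     (\<forall>X\<in>Obj C. \<forall>Y\<in>Obj C. comm_group (Hom_group C pl zr X Y)) \<and>
     (\<forall>X\<in>Obj C. \<forall>Y\<in>Obj C. \<forall>Z\<in>Obj C.
        (\<forall>f\<in>Hom C X Y. \<forall>g\<in>Hom C Y Z. \<forall>h\<in>Hom C Y Z.
           pl g h \<cdot>\<^bsub>C\<^esub> f = pl (g \<cdot>\<^bsub>C\<^esub> f) (h \<cdot>\<^bsub>C\<^esub> f)) \<and>
        (\<forall>f\<in>Hom C X Y. \<forall>g\<in>Hom C X Y. \<forall>h\<in>Hom C Y Z.
           h \<cdot>\<^bsub>C\<^esub> pl f g = pl (h \<cdot>\<^bsub>C\<^esub> f) (h \<cdot>\<^bsub>C\<^esub> g)))"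

definition has_biproducts :: "('o, 'a) cat \<Rightarrow> ('a \<Rightarrow> 'a \<Rightarrow> 'a) \<Rightarrow> bool" where
  "has_biproducts C pl \<longleftrightarrow>
     (\<forall>X\<in>Obj C. \<forall>Y\<in>Obj C. \<exists>S\<in>Obj C.
        \<exists>i\<in>Hom C X S. \<exists>j\<in>Hom C Y S. \<exists>p\<in>Hom C S X. \<exists>q\<in>Hom C S Y.
          p \<cdot>\<^bsub>C\<^esub> i = Ident C X \<and> q \<cdot>\<^bsub>C\<^esub> j = Ident C Y \<and>
          pl (i \<cdot>\<^bsub>C\<^esub> p) (j \<cdot>\<^bsub>C\<^esub> q) = Ident C S)"

definition abelian :: "('o, 'a) cat \<Rightarrow> bool" where
  "abelian C \<longleftrightarrow> category C \<and>
     (\<exists>pl zr. preadditive C pl zr \<and> has_biproducts C pl) \<and>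
     (\<exists>Z. is_zero_object C Z) \<and>
     (\<forall>f\<in>Arr C. \<exists>m. is_kernel C f m) \<and>
     (\<forall>f\<in>Arr C. \<exists>e. is_cokernel C f e) \<and>
     (\<forall>m. is_mono C m \<longrightarrow> (\<exists>f. is_kernel C f m)) \<and>
     (\<forall>e. is_epi C e \<longrightarrow> (\<exists>f. is_cokernel C f e))"

section \<open>Functors and functor categories\<close>

record ('o1, 'a1, 'o2, 'a2) fnctr =
  fobj :: "'o1 \<Rightarrow> 'o2"
  farr :: "'a1 \<Rightarrow> 'a2"

text \<open>Functors are required to be \<^const>\<open>undefined\<close> outside their source category, so that
  equality of functors is equality in the logic; likewise for natural transformations.\<close>

definition is_functor ::
  "('o1, 'a1) cat \<Rightarrow> ('o2, 'a2) cat \<Rightarrow> ('o1, 'a1, 'o2, 'a2) fnctr \<Rightarrow> bool" where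
  "is_functor C D T \<longleftrightarrow>
     fobj T \<in> extensional (Obj C) \<and> farr T \<in> extensional (Arr C) \<and>
     (\<forall>X\<in>Obj C. fobj T X \<in> Obj D) \<and>
     (\<forall>X\<in>Obj C. \<forall>Y\<in>Obj C. \<forall>f\<in>Hom C X Y. farr T f \<in> Hom D (fobj T X) (fobj T Y)) \<and>
     (\<forall>X\<in>Obj C. farr T (Ident C X) = Ident D (fobj T X)) \<and>
     (\<forall>X\<in>Obj C. \<forall>Y\<in>Obj C. \<forall>Z\<in>Obj C. \<forall>f\<in>Hom C X Y. \<forall>g\<in>Hom C Y Z.
        farr T (g \<cdot>\<^bsub>C\<^esub> f) = farr T g \<cdot>\<^bsub>D\<^esub> farr T f)"

definition id_functor :: "('o, 'a) cat \<Rightarrow> ('o, 'a, 'o, 'a) fnctr" where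
  "id_functor C = \<lparr>fobj = restrict (\<lambda>X. X) (Obj C), farr = restrict (\<lambda>f. f) (Arr C)\<rparr>"

definition comp_functor ::
  "('o1, 'a1) cat \<Rightarrow> ('o2, 'a2, 'o3, 'a3) fnctr \<Rightarrow> ('o1, 'a1, 'o2, 'a2) fnctr
     \<Rightarrow> ('o1, 'a1, 'o3, 'a3) fnctr" where
  "comp_functor C T S = \<lparr>fobj = compose (Obj C) (fobj T) (fobj S),
                         farr = compose (Arr C) (farr T) (farr S)\<rparr>"

record ('o1, 'a1, 'o2, 'a2) ntrans =
  nsrc :: "('o1, 'a1, 'o2, 'a2) fnctr"
  ntgt :: "('o1, 'a1, 'o2, 'a2) fnctr"
  ncmp :: "'o1 \<Rightarrow> 'a2"

definition is_ntrans ::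
  "('o1, 'a1) cat \<Rightarrow> ('o2, 'a2) cat \<Rightarrow> ('o1, 'a1, 'o2, 'a2) ntrans \<Rightarrow> bool" where
  "is_ntrans C D t \<longleftrightarrow>
     is_functor C D (nsrc t) \<and> is_functor C D (ntgt t) \<and> ncmp t \<in> extensional (Obj C) \<and>
     (\<forall>X\<in>Obj C. ncmp t X \<in> Hom D (fobj (nsrc t) X) (fobj (ntgt t) X)) \<and>
     (\<forall>X\<in>Obj C. \<forall>Y\<in>Obj C. \<forall>f\<in>Hom C X Y.
        farr (ntgt t) f \<cdot>\<^bsub>D\<^esub> ncmp t X = ncmp t Y \<cdot>\<^bsub>D\<^esub> farr (nsrc t) f)"

definition functor_cat ::
  "('o1, 'a1) cat \<Rightarrow> ('o2, 'a2) cat \<Rightarrow>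
     (('o1, 'a1, 'o2, 'a2) fnctr, ('o1, 'a1, 'o2, 'a2) ntrans) cat" where
  "functor_cat C D =
     \<lparr>Obj = {T. is_functor C D T}, Arr = {t. is_ntrans C D t}, Dom = nsrc, Cod = ntgt,
      Ident = (\<lambda>T. \<lparr>nsrc = T, ntgt = T, ncmp = restrict (\<lambda>X. Ident D (fobj T X)) (Obj C)\<rparr>),
      Comp = (\<lambda>t s. \<lparr>nsrc = nsrc s, ntgt = ntgt t,
                     ncmp = restrict (\<lambda>X. ncmp t X \<cdot>\<^bsub>D\<^esub> ncmp s X) (Obj C)\<rparr>)\<rparr>"

text \<open>\<open>whisker C D K t H\<close> is \<open>K t H : K S H \<rightarrow> K T H\<close>, for \<open>t : S \<rightarrow> T\<close> and \<open>H\<close> with source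
  category \<open>C\<close>; \<open>D\<close> is the target category of \<open>H\<close>.\<close>

definition whisker ::
  "('o1, 'a1) cat \<Rightarrow> ('o2, 'a2) cat \<Rightarrow> ('o3, 'a3, 'o4, 'a4) fnctr \<Rightarrow>
   ('o2, 'a2, 'o3, 'a3) ntrans \<Rightarrow> ('o1, 'a1, 'o2, 'a2) fnctr \<Rightarrow> ('o1, 'a1, 'o4, 'a4) ntrans" where
  "whisker C D K t H =
     \<lparr>nsrc = comp_functor C (comp_functor D K (nsrc t)) H,
      ntgt = comp_functor C (comp_functor D K (ntgt t)) H,
      ncmp = restrict (\<lambda>X. farr K (ncmp t (fobj H X))) (Obj C)\<rparr>"

section \<open>Smallness and bicompleteness\<close>

text \<open>Size is measured against a type \<open>'u\<close> playing the role of the class of all sets: a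
  collection is small (``is a set'') iff its cardinality is strictly below that of \<open>'u\<close>
  (limitation of size). No closure property of the cardinal of \<open>'u\<close> is imposed; the usual notions
  arise when it is inaccessible. Every small category is isomorphic to one with
  objects and arrows in \<open>'u\<close>, so it suffices to index diagrams by such categories.\<close>

definition small :: "'u itself \<Rightarrow> 'x set \<Rightarrow> bool" where
  "small _ X \<longleftrightarrow> X \<prec> (UNIV :: 'u set)"

definition has_small_Homs :: "'u itself \<Rightarrow> ('o, 'a) cat \<Rightarrow> bool" where
  "has_small_Homs U C \<longleftrightarrow> (\<forall>X\<in>Obj C. \<forall>Y\<in>Obj C. small U (Hom C X Y))"

definition is_cone ::
  "('i, 'j) cat \<Rightarrow> ('o, 'a) cat \<Rightarrow> ('i, 'j, 'o, 'a) fnctr \<Rightarrow> 'o \<Rightarrow> ('i \<Rightarrow> 'a) \<Rightarrow> bool" where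
  "is_cone J C T L p \<longleftrightarrow> L \<in> Obj C \<and> (\<forall>i\<in>Obj J. p i \<in> Hom C L (fobj T i)) \<and>
     (\<forall>i\<in>Obj J. \<forall>j\<in>Obj J. \<forall>f\<in>Hom J i j. farr T f \<cdot>\<^bsub>C\<^esub> p i = p j)"

definition is_limit ::
  "('i, 'j) cat \<Rightarrow> ('o, 'a) cat \<Rightarrow> ('i, 'j, 'o, 'a) fnctr \<Rightarrow> 'o \<Rightarrow> ('i \<Rightarrow> 'a) \<Rightarrow> bool" where
  "is_limit J C T L p \<longleftrightarrow> is_cone J C T L p \<and>
     (\<forall>Q q. is_cone J C T Q q \<longrightarrow> (\<exists>!u. u \<in> Hom C Q L \<and> (\<forall>i\<in>Obj J. p i \<cdot>\<^bsub>C\<^esub> u = q i)))"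

definition is_cocone ::
  "('i, 'j) cat \<Rightarrow> ('o, 'a) cat \<Rightarrow> ('i, 'j, 'o, 'a) fnctr \<Rightarrow> 'o \<Rightarrow> ('i \<Rightarrow> 'a) \<Rightarrow> bool" where
  "is_cocone J C T L p \<longleftrightarrow> L \<in> Obj C \<and> (\<forall>i\<in>Obj J. p i \<in> Hom C (fobj T i) L) \<and>
     (\<forall>i\<in>Obj J. \<forall>j\<in>Obj J. \<forall>f\<in>Hom J i j. p j \<cdot>\<^bsub>C\<^esub> farr T f = p i)"

definition is_colimit ::
  "('i, 'j) cat \<Rightarrow> ('o, 'a) cat \<Rightarrow> ('i, 'j, 'o, 'a) fnctr \<Rightarrow> 'o \<Rightarrow> ('i \<Rightarrow> 'a) \<Rightarrow> bool" where
  "is_colimit J C T L p \<longleftrightarrow> is_cocone J C T L p \<and>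
     (\<forall>Q q. is_cocone J C T Q q \<longrightarrow> (\<exists>!u. u \<in> Hom C L Q \<and> (\<forall>i\<in>Obj J. u \<cdot>\<^bsub>C\<^esub> p i = q i)))"

definition complete_cat :: "'u itself \<Rightarrow> ('o, 'a) cat \<Rightarrow> bool" where
  "complete_cat U C \<longleftrightarrow>
     (\<forall>(J :: ('u, 'u) cat) T. category J \<and> small U (Arr J) \<and> is_functor J C T \<longrightarrow>
        (\<exists>L p. is_limit J C T L p))"

definition cocomplete_cat :: "'u itself \<Rightarrow> ('o, 'a) cat \<Rightarrow> bool" where
  "cocomplete_cat U C \<longleftrightarrow>
     (\<forall>(J :: ('u, 'u) cat) T. category J \<and> small U (Arr J) \<and> is_functor J C T \<longrightarrow>
        (\<exists>L p. is_colimit J C T L p))"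

definition bicomplete :: "'u itself \<Rightarrow> ('o, 'a) cat \<Rightarrow> bool" where
  "bicomplete U C \<longleftrightarrow> complete_cat U C \<and> cocomplete_cat U C"

section \<open>Preradicals\<close>

definition Pr :: "('o, 'a) cat \<Rightarrow> ('o, 'a, 'o, 'a) ntrans set set" where
  "Pr C = subobjects (functor_cat C C) (id_functor C)"

section \<open>Adjoint pairs and the induced Galois connection\<close>

definition adjoint_pair ::
  "('oa, 'aa) cat \<Rightarrow> ('ob, 'ab) cat \<Rightarrow> ('oa, 'aa, 'ob, 'ab) fnctr \<Rightarrow> ('ob, 'ab, 'oa, 'aa) fnctr \<Rightarrow>
   ('oa, 'aa, 'oa, 'aa) ntrans \<Rightarrow> ('ob, 'ab, 'ob, 'ab) ntrans \<Rightarrow> bool" where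
  "adjoint_pair A B F G \<eta> \<epsilon> \<longleftrightarrow>
     is_functor A B F \<and> is_functor B A G \<and>
     \<eta> \<in> Hom (functor_cat A A) (id_functor A) (comp_functor A G F) \<and>
     \<epsilon> \<in> Hom (functor_cat B B) (comp_functor B F G) (id_functor B) \<and>
     (\<forall>X\<in>Obj A. ncmp \<epsilon> (fobj F X) \<cdot>\<^bsub>B\<^esub> farr F (ncmp \<eta> X) = Ident B (fobj F X)) \<and>
     (\<forall>Y\<in>Obj B. farr G (ncmp \<epsilon> Y) \<cdot>\<^bsub>A\<^esub> ncmp \<eta> (fobj G Y) = Ident A (fobj G Y))"

text \<open>In both maps \<open>SOME t. t \<in> P\<close> picks a representative of the preradical \<open>P\<close>.\<close>

definition galois_phi ::
  "('oa, 'aa) cat \<Rightarrow> ('ob, 'ab) cat \<Rightarrow> ('oa, 'aa, 'ob, 'ab) fnctr \<Rightarrow> ('ob, 'ab, 'oa, 'aa) fnctr \<Rightarrow>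
   ('ob, 'ab, 'ob, 'ab) ntrans \<Rightarrow>
   ('oa, 'aa, 'oa, 'aa) ntrans set \<Rightarrow> ('ob, 'ab, 'ob, 'ab) ntrans set" where
  "galois_phi A B F G \<epsilon> =
     restrict (\<lambda>P. let \<tau> = (SOME t. t \<in> P)
                   in image_subobject (functor_cat B B) (\<epsilon> \<cdot>\<^bsub>functor_cat B B\<^esub> whisker B A F \<tau> G)) (Pr A)"

definition galois_psi ::
  "('oa, 'aa) cat \<Rightarrow> ('ob, 'ab) cat \<Rightarrow> ('oa, 'aa, 'ob, 'ab) fnctr \<Rightarrow> ('ob, 'ab, 'oa, 'aa) fnctr \<Rightarrow>
   ('oa, 'aa, 'oa, 'aa) ntrans \<Rightarrow>
   ('ob, 'ab, 'ob, 'ab) ntrans set \<Rightarrow> ('oa, 'aa, 'oa, 'aa) ntrans set" where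
  "galois_psi A B F G \<eta> =
     restrict (\<lambda>P. let \<sigma> = (SOME t. t \<in> P);
                       \<pi> = some_cokernel (functor_cat A A) (whisker A B G \<sigma> F)
                   in Ker (functor_cat A A) (\<pi> \<cdot>\<^bsub>functor_cat A A\<^esub> \<eta>)) (Pr B)"

definition induced_galois ::
  "('oa, 'aa) cat \<Rightarrow> ('ob, 'ab) cat \<Rightarrow> ('oa, 'aa, 'ob, 'ab) fnctr \<Rightarrow> ('ob, 'ab, 'oa, 'aa) fnctr \<Rightarrow>
   ('oa, 'aa, 'oa, 'aa) ntrans \<Rightarrow> ('ob, 'ab, 'ob, 'ab) ntrans \<Rightarrow>
   (('oa, 'aa, 'oa, 'aa) ntrans set \<Rightarrow> ('ob, 'ab, 'ob, 'ab) ntrans set) \<times>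
   (('ob, 'ab, 'ob, 'ab) ntrans set \<Rightarrow> ('oa, 'aa, 'oa, 'aa) ntrans set)" where
  "induced_galois A B F G \<eta> \<epsilon> = (galois_phi A B F G \<epsilon>, galois_psi A B F G \<eta>)"

section \<open>Omega preradicals\<close>

definition is_product ::
  "('o, 'a) cat \<Rightarrow> 'i set \<Rightarrow> ('i \<Rightarrow> 'o) \<Rightarrow> 'o \<Rightarrow> ('i \<Rightarrow> 'a) \<Rightarrow> bool" where
  "is_product C I X P p \<longleftrightarrow> P \<in> Obj C \<and> (\<forall>i\<in>I. p i \<in> Hom C P (X i)) \<and>
     (\<forall>Q\<in>Obj C. \<forall>q. (\<forall>i\<in>I. q i \<in> Hom C Q (X i)) \<longrightarrow>
        (\<exists>!u. u \<in> Hom C Q P \<and> (\<forall>i\<in>I. p i \<cdot>\<^bsub>C\<^esub> u = q i)))"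

definition chosen_power :: "('o, 'a) cat \<Rightarrow> 'o \<Rightarrow> 'i set \<Rightarrow> 'o \<times> ('i \<Rightarrow> 'a)" where
  "chosen_power C M I = (SOME Pp. is_product C I (\<lambda>_. M) (fst Pp) (snd Pp))"

definition power_obj :: "('o, 'a) cat \<Rightarrow> 'o \<Rightarrow> 'i set \<Rightarrow> 'o" where
  "power_obj C M I = fst (chosen_power C M I)"

definition power_proj :: "('o, 'a) cat \<Rightarrow> 'o \<Rightarrow> 'i set \<Rightarrow> 'i \<Rightarrow> 'a" where
  "power_proj C M I = snd (chosen_power C M I)"

text \<open>The contravariant functor \<open>M\<^sup>-\<close> on a function \<open>h : I \<rightarrow> J\<close>, i.e. \<open>M\<^sup>h : M\<^sup>J \<rightarrow> M\<^sup>I\<close>.\<close>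

definition power_map :: "('o, 'a) cat \<Rightarrow> 'o \<Rightarrow> 'i set \<Rightarrow> 'j set \<Rightarrow> ('i \<Rightarrow> 'j) \<Rightarrow> 'a" where
  "power_map C M I J h =
     (THE u. u \<in> Hom C (power_obj C M J) (power_obj C M I) \<and>
             (\<forall>i\<in>I. power_proj C M I i \<cdot>\<^bsub>C\<^esub> u = power_proj C M J (h i)))"

definition omega_functor :: "('o, 'a) cat \<Rightarrow> 'o \<Rightarrow> 'o \<Rightarrow> ('o, 'a, 'o, 'a) fnctr" where
  "omega_functor C N M =
     \<lparr>fobj = restrict (\<lambda>L. power_obj C M (Hom C L N)) (Obj C),
      farr = restrict (\<lambda>g. power_map C M (Hom C (Cod C g) N) (Hom C (Dom C g) N)
                              (\<lambda>f. f \<cdot>\<^bsub>C\<^esub> g)) (Arr C)\<rparr>"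

definition omega_trans :: "('o, 'a) cat \<Rightarrow> 'a \<Rightarrow> ('o, 'a, 'o, 'a) ntrans" where
  "omega_trans C k =
     \<lparr>nsrc = id_functor C,
      ntgt = omega_functor C (Dom C k) (Cod C k),
      ncmp = restrict (\<lambda>L. THE u.
        u \<in> Hom C L (power_obj C (Cod C k) (Hom C L (Dom C k))) \<and>
        (\<forall>f\<in>Hom C L (Dom C k).
           power_proj C (Cod C k) (Hom C L (Dom C k)) f \<cdot>\<^bsub>C\<^esub> u = k \<cdot>\<^bsub>C\<^esub> f)) (Obj C)\<rparr>"

definition omega :: "('o, 'a) cat \<Rightarrow> 'a \<Rightarrow> ('o, 'a, 'o, 'a) ntrans set" where
  "omega C k = Ker (functor_cat C C) (omega_trans C k)"

end

theory Submission
  imports Defs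
begin

text \<open>A kernel of \<open>f\<close> depends on \<open>f\<close> only through the source of \<open>f\<close> and the arrows \<open>h\<close> with
  \<open>f \<cdot> h\<close> zero, so it suffices that \<open>\<pi> \<cdot> \<eta> \<cdot> h\<close> is zero iff \<open>\<^bold>W\<^bsub>G k\<^esub> \<cdot> h\<close> is, for every
  \<open>h : H \<rightarrow> 1\<^sub>A\<close>. By adjunction, the component of the latter at \<open>X\<close> is zero iff \<open>\<^bold>W\<^sub>k \<cdot> F h\<close> is zero
  at \<open>F X\<close>. If so, \<open>F h\<close> factors at \<open>F X\<close> through \<open>\<sigma>\<close>, since kernels in functor categories are
  pointwise; transposing, \<open>\<eta> \<cdot> h\<close> factors through \<open>G \<sigma> F\<close>, which \<open>\<pi>\<close> kills. Conversely,
  \<open>G \<^bold>W\<^sub>k F\<close> kills \<open>G \<sigma> F\<close> and hence factors through \<open>\<pi>\<close>.\<close>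

section \<open>Zero arrows and kernels\<close>

text \<open>Two factorizations carry the argument, and they differ in kind. The one through
  \<open>\<sigma>\<close> concerns a single arrow of \<open>B\<close>, the image under
  \<open>F\<close> of one component of \<open>h\<close>. It needs a kernel in the functor category
  whose components are kernels, and the property must then be carried over to the arbitrary
  representative \<open>\<sigma>\<close>. The one through \<open>\<pi>\<close> takes place between
  natural transformations, because \<open>\<pi>\<close> is an arbitrary cokernel in the functor
  category, and is evaluated at an object only afterwards. Hence kernels in functor categories are
  constructed together with a statement on components, cokernels as mere existence.

  Powers are never compared across the adjunction. An arrow into a power vanishes iff all its
  projections do, and transposition matches the index set \<open>Hom A X (fobj G N)\<close> with
  \<open>Hom B (fobj F X) N\<close>.

  The conclusion is an equality of equivalence classes, not an isomorphism: \<open>Ker\<close>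
  chooses from a predicate, and the two predicates turn out to be equal.\<close>

lemma Hom_iff: "f \<in> Hom C X Y \<longleftrightarrow> f \<in> Arr C \<and> Dom C f = X \<and> Cod C f = Y"
  by (auto simp: Hom_def)

lemma Arr_Hom: "f \<in> Arr C \<Longrightarrow> f \<in> Hom C (Dom C f) (Cod C f)"
  by (simp add: Hom_def)

context category
begin

lemma Hom_Obj: "f \<in> Hom C X Y \<Longrightarrow> X \<in> Obj C \<and> Y \<in> Obj C"
  using Dom_Obj Cod_Obj by (auto simp: Hom_def)

lemma zero_object_arrows:
  assumes "is_zero_object C Z" "X \<in> Obj C"
  shows "\<exists>f. f \<in> Hom C X Z" "\<exists>f. f \<in> Hom C Z X"
  using assms unfolding is_zero_object_def by (blast dest: ex1_implies_ex)+

lemma zero_object_unique: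
  assumes "is_zero_object C Z"
  shows "f \<in> Hom C X Z \<Longrightarrow> g \<in> Hom C X Z \<Longrightarrow> f = g"
    and "f \<in> Hom C Z X \<Longrightarrow> g \<in> Hom C Z X \<Longrightarrow> f = g"
  using assms Hom_Obj unfolding is_zero_object_def by blast+

lemma zero_arrowI:
  "is_zero_object C Z \<Longrightarrow> p \<in> Hom C X Z \<Longrightarrow> q \<in> Hom C Z Y \<Longrightarrow> is_zero_arrow C (q \<cdot> p)"
  using Comp_Hom[of p X Z q Y] unfolding is_zero_arrow_def Hom_iff by auto

text \<open>\<open>is_zero_arrow\<close> comes with a zero object of its own. Any two zero objects
  are isomorphic, so the factorization can be rerouted through a prescribed one, which lets
  different zero arrows be compared.\<close>

lemma zero_arrow_through:
  assumes "is_zero_arrow C f" "f \<in> Hom C X Y" "is_zero_object C Z"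
  shows "\<exists>p\<in>Hom C X Z. \<exists>q\<in>Hom C Z Y. f = q \<cdot> p"
proof -
  obtain Z' p' q' where Z': "is_zero_object C Z'"
    and p': "p' \<in> Hom C X Z'" and q': "q' \<in> Hom C Z' Y" and f: "f = q' \<cdot> p'"
    using assms(1,2) unfolding is_zero_arrow_def Hom_iff by auto
  have ZO: "Z \<in> Obj C" "Z' \<in> Obj C" using assms(3) Z' by (auto simp: is_zero_object_def)
  obtain i j where i: "i \<in> Hom C Z Z'" and j: "j \<in> Hom C Z' Z"
    using zero_object_arrows[OF assms(3) ZO(2)] by blast
  have "i \<cdot> j = Ident C Z'"
    using zero_object_unique(1)[OF Z' Comp_Hom[OF j i] Ident_Hom[OF ZO(2)]] .
  then have "f = (q' \<cdot> i) \<cdot> (j \<cdot> p')"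
    using f Comp_assoc[OF p' j i] Comp_assoc[OF Comp_Hom[OF p' j] i q'] Ident_Comp[OF p']
    by simp
  then show ?thesis using Comp_Hom[OF p' j] Comp_Hom[OF i q'] by blast
qed

text \<open>This takes the place of the equation "f = 0": an arrow is shown to be zero by exhibiting
  a zero arrow with the same source and target and proving the two equal.\<close>

lemma zero_arrow_unique:
  assumes "is_zero_arrow C f" "is_zero_arrow C g" "f \<in> Hom C X Y" "g \<in> Hom C X Y"
  shows "f = g"
proof -
  obtain Z where Z: "is_zero_object C Z" using assms(1) by (auto simp: is_zero_arrow_def)
  obtain p q p' q' where "p \<in> Hom C X Z" "q \<in> Hom C Z Y" "f = q \<cdot> p"
      "p' \<in> Hom C X Z" "q' \<in> Hom C Z Y" "g = q' \<cdot> p'"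
    using zero_arrow_through[OF assms(1,3) Z] zero_arrow_through[OF assms(2,4) Z] by blast
  moreover have "p = p'" "q = q'" using calculation zero_object_unique[OF Z] by blast+
  ultimately show ?thesis by simp
qed

lemma zero_arrow_comp_left:
  assumes "is_zero_arrow C f" "f \<in> Hom C X Y" "g \<in> Hom C Y W"
  shows "is_zero_arrow C (g \<cdot> f)"
proof -
  obtain Z where Z: "is_zero_object C Z" using assms(1) by (auto simp: is_zero_arrow_def)
  obtain p q where pq: "p \<in> Hom C X Z" "q \<in> Hom C Z Y" "f = q \<cdot> p"
    using zero_arrow_through[OF assms(1,2) Z] by blast
  then have "g \<cdot> f = (g \<cdot> q) \<cdot> p" using Comp_assoc[OF pq(1,2) assms(3)] by simp
  then show ?thesis using zero_arrowI[OF Z pq(1) Comp_Hom[OF pq(2) assms(3)]] by simp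
qed

lemma zero_arrow_comp_right:
  assumes "is_zero_arrow C g" "f \<in> Hom C X Y" "g \<in> Hom C Y W"
  shows "is_zero_arrow C (g \<cdot> f)"
proof -
  obtain Z where Z: "is_zero_object C Z" using assms(1) by (auto simp: is_zero_arrow_def)
  obtain p q where pq: "p \<in> Hom C Y Z" "q \<in> Hom C Z W" "g = q \<cdot> p"
    using zero_arrow_through[OF assms(1,3) Z] by blast
  then have "g \<cdot> f = q \<cdot> (p \<cdot> f)" using Comp_assoc[OF assms(2) pq(1,2)] by simp
  then show ?thesis using zero_arrowI[OF Z Comp_Hom[OF assms(2) pq(1)] pq(2)] by simp
qed

lemma ex_zero_arrow:
  assumes "is_zero_object C Z" "X \<in> Obj C" "Y \<in> Obj C"
  shows "\<exists>f\<in>Hom C X Y. is_zero_arrow C f"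
proof -
  obtain p q where "p \<in> Hom C X Z" "q \<in> Hom C Z Y"
    using zero_object_arrows[OF assms(1)] assms(2,3) by blast
  then show ?thesis using zero_arrowI[OF assms(1)] Comp_Hom by blast
qed

section \<open>Universal properties of kernels and cokernels\<close>

lemma kernel_ex1:
  assumes "is_kernel C f m" "f \<in> Hom C Y Z" "h \<in> Hom C X Y" "is_zero_arrow C (f \<cdot> h)"
  shows "\<exists>!u. u \<in> Hom C X (Dom C m) \<and> m \<cdot> u = h"
proof -
  have h: "h \<in> Arr C" "Cod C h = Dom C f" "Dom C h = X" using assms(2,3) by (simp_all add: Hom_iff)
  have "\<exists>!u. u \<in> Hom C (Dom C h) (Dom C m) \<and> m \<cdot> u = h"
    using assms(1,4) h(1,2) unfolding is_kernel_def by blast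
  then show ?thesis using h(3) by simp
qed

lemma kernel_mono:
  assumes "is_kernel C f m"
  shows "is_mono C m"
  unfolding is_mono_def
proof (intro conjI ballI impI)
  show m: "m \<in> Arr C" using assms by (simp add: is_kernel_def)
  have f: "f \<in> Hom C (Cod C m) (Cod C f)" using assms by (simp add: is_kernel_def Hom_def)
  fix X u v
  assume u: "u \<in> Hom C X (Dom C m)" and v: "v \<in> Hom C X (Dom C m)" and eq: "m \<cdot> u = m \<cdot> v"
  have mu: "m \<cdot> u \<in> Hom C X (Cod C m)" using Comp_Hom[OF u Arr_Hom[OF m]] .
  have "is_zero_arrow C ((f \<cdot> m) \<cdot> u)"
    using assms zero_arrow_comp_right[OF _ u Comp_Hom[OF Arr_Hom[OF m] f]]
    by (simp add: is_kernel_def)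
  then have "is_zero_arrow C (f \<cdot> (m \<cdot> u))"
    using Comp_assoc[OF u Arr_Hom[OF m] f] by simp
  then have "\<exists>!w. w \<in> Hom C X (Dom C m) \<and> m \<cdot> w = m \<cdot> u"
    using kernel_ex1[OF assms f mu] by simp
  then show "u = v" using u v eq by metis
qed

lemma monoD:
  assumes "is_mono C m" "m \<in> Hom C Y Z" "f \<in> Hom C X Y" "g \<in> Hom C X Y" "m \<cdot> f = m \<cdot> g"
  shows "f = g"
  using assms Hom_Obj[OF assms(3)] unfolding is_mono_def by (auto simp: Hom_iff)

lemma kernel_factor:
  assumes "is_kernel C f m" "f \<in> Hom C Y Z" "h \<in> Hom C X Y" "is_zero_arrow C (f \<cdot> h)"
  shows "\<exists>u\<in>Hom C X (Dom C m). m \<cdot> u = h"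
  using ex1_implies_ex[OF kernel_ex1[OF assms]] by blast

lemma cokernel_ex1:
  assumes "is_cokernel C f e" "f \<in> Hom C X Y" "h \<in> Hom C Y Z" "is_zero_arrow C (h \<cdot> f)"
  shows "\<exists>!u. u \<in> Hom C (Cod C e) Z \<and> u \<cdot> e = h"
proof -
  have h: "h \<in> Arr C" "Dom C h = Cod C f" "Cod C h = Z" using assms(2,3) by (simp_all add: Hom_iff)
  have "\<exists>!u. u \<in> Hom C (Cod C e) (Cod C h) \<and> u \<cdot> e = h"
    using assms(1,4) h(1,2) unfolding is_cokernel_def by blast
  then show ?thesis using h(3) by simp
qed

lemma cokernel_epi:
  assumes "is_cokernel C f e"
  shows "is_epi C e"
  unfolding is_epi_def
proof (intro conjI ballI impI)
  show e: "e \<in> Arr C" using assms by (simp add: is_cokernel_def)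
  have f: "f \<in> Hom C (Dom C f) (Dom C e)" using assms by (simp add: is_cokernel_def Hom_def)
  fix X u v
  assume u: "u \<in> Hom C (Cod C e) X" and v: "v \<in> Hom C (Cod C e) X" and eq: "u \<cdot> e = v \<cdot> e"
  have ue: "u \<cdot> e \<in> Hom C (Dom C e) X" using Comp_Hom[OF Arr_Hom[OF e] u] .
  have "is_zero_arrow C (u \<cdot> (e \<cdot> f))"
    using assms zero_arrow_comp_left[OF _ Comp_Hom[OF f Arr_Hom[OF e]] u]
    by (simp add: is_cokernel_def)
  then have "is_zero_arrow C ((u \<cdot> e) \<cdot> f)"
    using Comp_assoc[OF f Arr_Hom[OF e] u] by simp
  then have "\<exists>!w. w \<in> Hom C (Cod C e) X \<and> w \<cdot> e = u \<cdot> e"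
    using cokernel_ex1[OF assms f ue] by simp
  then show "u = v" using u v eq by metis
qed

lemma epiD:
  assumes "is_epi C e" "e \<in> Hom C X Y" "f \<in> Hom C Y Z" "g \<in> Hom C Y Z" "f \<cdot> e = g \<cdot> e"
  shows "f = g"
  using assms Hom_Obj[OF assms(3)] unfolding is_epi_def by (auto simp: Hom_iff)

lemma cokernel_factor:
  assumes "is_cokernel C f e" "f \<in> Hom C X Y" "h \<in> Hom C Y Z" "is_zero_arrow C (h \<cdot> f)"
  shows "\<exists>u\<in>Hom C (Cod C e) Z. u \<cdot> e = h"
  using ex1_implies_ex[OF cokernel_ex1[OF assms]] by blast

end

text \<open>Both arrows have literally the same kernels, so the \<open>SOME\<close> in
  \<open>Ker\<close> returns the same one. The targets of \<open>f\<close> and \<open>f'\<close> may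
  differ, as those of \<open>\<pi> \<cdot> \<eta>\<close> and of the omega transformation
  do.\<close>

lemma Ker_cong:
  assumes "f \<in> Arr C" "f' \<in> Arr C" "Dom C f = Dom C f'"
    and "\<And>h. h \<in> Arr C \<Longrightarrow> Cod C h = Dom C f \<Longrightarrow>
           is_zero_arrow C (f \<cdot>\<^bsub>C\<^esub> h) \<longleftrightarrow> is_zero_arrow C (f' \<cdot>\<^bsub>C\<^esub> h)"
  shows "Ker C f = Ker C f'"
proof -
  have "is_kernel C f m \<longleftrightarrow> is_kernel C f' m" for m
  proof -
    have *: "(h \<in> Arr C \<and> Cod C h = Dom C f \<and> is_zero_arrow C (f \<cdot>\<^bsub>C\<^esub> h)) \<longleftrightarrow>
        (h \<in> Arr C \<and> Cod C h = Dom C f' \<and> is_zero_arrow C (f' \<cdot>\<^bsub>C\<^esub> h))" for h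
      using assms(3,4) by auto
    show ?thesis using assms(1,2) *[of m] * unfolding is_kernel_def Ball_def by blast
  qed
  then show ?thesis by (simp add: Ker_def)
qed

section \<open>Functor categories\<close>

lemma functor_cat_simps [simp]:
  "T \<in> Obj (functor_cat C D) \<longleftrightarrow> is_functor C D T"
  "t \<in> Arr (functor_cat C D) \<longleftrightarrow> is_ntrans C D t"
  "Dom (functor_cat C D) = nsrc"
  "Cod (functor_cat C D) = ntgt"
  "nsrc (t \<cdot>\<^bsub>functor_cat C D\<^esub> s) = nsrc s"
  "ntgt (t \<cdot>\<^bsub>functor_cat C D\<^esub> s) = ntgt t"
  "X \<in> Obj C \<Longrightarrow> ncmp (t \<cdot>\<^bsub>functor_cat C D\<^esub> s) X = ncmp t X \<cdot>\<^bsub>D\<^esub> ncmp s X"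
  by (auto simp: functor_cat_def)

lemma Hom_functor_cat [simp]:
  "t \<in> Hom (functor_cat C D) S T \<longleftrightarrow> is_ntrans C D t \<and> nsrc t = S \<and> ntgt t = T"
  by (simp add: Hom_iff)

lemma functor_obj: "is_functor C D T \<Longrightarrow> X \<in> Obj C \<Longrightarrow> fobj T X \<in> Obj D"
  by (simp add: is_functor_def)

lemma (in category) functor_Hom:
  "is_functor C D T \<Longrightarrow> f \<in> Hom C X Y \<Longrightarrow> farr T f \<in> Hom D (fobj T X) (fobj T Y)"
  using Hom_Obj unfolding is_functor_def by blast

lemma (in category) functor_Comp:
  "is_functor C D T \<Longrightarrow> f \<in> Hom C X Y \<Longrightarrow> g \<in> Hom C Y Z \<Longrightarrow>
     farr T (g \<cdot> f) = farr T g \<cdot>\<^bsub>D\<^esub> farr T f"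
  using Hom_Obj unfolding is_functor_def by meson

lemma functor_Ident:
  "is_functor C D T \<Longrightarrow> X \<in> Obj C \<Longrightarrow> farr T (Ident C X) = Ident D (fobj T X)"
  by (simp add: is_functor_def)

lemma (in category) functorI:
  assumes "fobj T \<in> extensional (Obj C)" "farr T \<in> extensional (Arr C)"
    and "\<And>X. X \<in> Obj C \<Longrightarrow> fobj T X \<in> Obj D"
    and "\<And>X Y f. f \<in> Hom C X Y \<Longrightarrow> farr T f \<in> Hom D (fobj T X) (fobj T Y)"
    and "\<And>X. X \<in> Obj C \<Longrightarrow> farr T (Ident C X) = Ident D (fobj T X)"
    and "\<And>X Y Z f g. f \<in> Hom C X Y \<Longrightarrow> g \<in> Hom C Y Z \<Longrightarrow>
           farr T (g \<cdot> f) = farr T g \<cdot>\<^bsub>D\<^esub> farr T f"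
  shows "is_functor C D T"
  using assms unfolding is_functor_def by simp

lemma ntrans_functors: "is_ntrans C D t \<Longrightarrow> is_functor C D (nsrc t) \<and> is_functor C D (ntgt t)"
  by (simp add: is_ntrans_def)

lemma ntrans_Hom:
  "is_ntrans C D t \<Longrightarrow> X \<in> Obj C \<Longrightarrow> ncmp t X \<in> Hom D (fobj (nsrc t) X) (fobj (ntgt t) X)"
  by (simp add: is_ntrans_def)

lemma (in category) ntrans_nat:
  "is_ntrans C D t \<Longrightarrow> f \<in> Hom C X Y \<Longrightarrow>
     farr (ntgt t) f \<cdot>\<^bsub>D\<^esub> ncmp t X = ncmp t Y \<cdot>\<^bsub>D\<^esub> farr (nsrc t) f"
  using Hom_Obj unfolding is_ntrans_def by meson

lemma (in category) ntransI:
  assumes "is_functor C D (nsrc t)" "is_functor C D (ntgt t)" "ncmp t \<in> extensional (Obj C)"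
    and "\<And>X. X \<in> Obj C \<Longrightarrow> ncmp t X \<in> Hom D (fobj (nsrc t) X) (fobj (ntgt t) X)"
    and "\<And>X Y f. X \<in> Obj C \<Longrightarrow> Y \<in> Obj C \<Longrightarrow> f \<in> Hom C X Y \<Longrightarrow>
           farr (ntgt t) f \<cdot>\<^bsub>D\<^esub> ncmp t X = ncmp t Y \<cdot>\<^bsub>D\<^esub> farr (nsrc t) f"
  shows "is_ntrans C D t"
  using assms unfolding is_ntrans_def by simp

text \<open>Component functions are \<open>extensional\<close>, hence determined by their values on
  objects. This turns componentwise identities into equality of arrows of the functor
  category.\<close>

lemma ntrans_eqI:
  fixes s t :: "('o1, 'a1, 'o2, 'a2) ntrans"
  assumes "is_ntrans C D s" "is_ntrans C D t" "nsrc s = nsrc t" "ntgt s = ntgt t"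
    and "\<And>X. X \<in> Obj C \<Longrightarrow> ncmp s X = ncmp t X"
  shows "s = t"
proof -
  have "ncmp s = ncmp t"
    using assms unfolding is_ntrans_def by (intro extensionalityI[of _ "Obj C"]) auto
  then show ?thesis using assms(3,4) by simp
qed

section \<open>The category structure on functors and natural transformations\<close>

locale category_pair = C: category C + D: category D
  for C :: "('o1, 'a1) cat" and D :: "('o2, 'a2) cat"
begin

lemma ntrans_Comp:
  assumes s: "is_ntrans C D s" and t: "is_ntrans C D t" and st: "ntgt s = nsrc t"
  shows "is_ntrans C D (t \<cdot>\<^bsub>functor_cat C D\<^esub> s)"
proof (rule C.ntransI)
  show "ncmp (t \<cdot>\<^bsub>functor_cat C D\<^esub> s) \<in> extensional (Obj C)"
    by (simp add: functor_cat_def)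
next
  fix X Y f assume X: "X \<in> Obj C" and Y: "Y \<in> Obj C" and f: "f \<in> Hom C X Y"
  note FS = conjunct1[OF ntrans_functors[OF s]] and FM = conjunct1[OF ntrans_functors[OF t]]
    and FT = conjunct2[OF ntrans_functors[OF t]]
  have sX: "ncmp s X \<in> Hom D (fobj (nsrc s) X) (fobj (nsrc t) X)"
    and sY: "ncmp s Y \<in> Hom D (fobj (nsrc s) Y) (fobj (nsrc t) Y)"
    using ntrans_Hom[OF s] X Y st by auto
  note tX = ntrans_Hom[OF t X] and tY = ntrans_Hom[OF t Y]
  have "farr (ntgt t) f \<cdot>\<^bsub>D\<^esub> (ncmp t X \<cdot>\<^bsub>D\<^esub> ncmp s X)
        = (farr (ntgt t) f \<cdot>\<^bsub>D\<^esub> ncmp t X) \<cdot>\<^bsub>D\<^esub> ncmp s X"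
    using D.Comp_assoc[OF sX tX C.functor_Hom[OF FT f]] by simp
  also have "\<dots> = (ncmp t Y \<cdot>\<^bsub>D\<^esub> farr (nsrc t) f) \<cdot>\<^bsub>D\<^esub> ncmp s X"
    using C.ntrans_nat[OF t f] by simp
  also have "\<dots> = ncmp t Y \<cdot>\<^bsub>D\<^esub> (farr (nsrc t) f \<cdot>\<^bsub>D\<^esub> ncmp s X)"
    using D.Comp_assoc[OF sX C.functor_Hom[OF FM f] tY] by simp
  also have "\<dots> = ncmp t Y \<cdot>\<^bsub>D\<^esub> (ncmp s Y \<cdot>\<^bsub>D\<^esub> farr (nsrc s) f)"
    using C.ntrans_nat[OF s f] st by simp
  also have "\<dots> = (ncmp t Y \<cdot>\<^bsub>D\<^esub> ncmp s Y) \<cdot>\<^bsub>D\<^esub> farr (nsrc s) f"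
    using D.Comp_assoc[OF C.functor_Hom[OF FS f] sY tY] by simp
  finally show "farr (ntgt (t \<cdot>\<^bsub>functor_cat C D\<^esub> s)) f \<cdot>\<^bsub>D\<^esub> ncmp (t \<cdot>\<^bsub>functor_cat C D\<^esub> s) X =
    ncmp (t \<cdot>\<^bsub>functor_cat C D\<^esub> s) Y \<cdot>\<^bsub>D\<^esub> farr (nsrc (t \<cdot>\<^bsub>functor_cat C D\<^esub> s)) f"
    using X Y by simp
next
  fix X assume X: "X \<in> Obj C"
  show "ncmp (t \<cdot>\<^bsub>functor_cat C D\<^esub> s) X
      \<in> Hom D (fobj (nsrc (t \<cdot>\<^bsub>functor_cat C D\<^esub> s)) X) (fobj (ntgt (t \<cdot>\<^bsub>functor_cat C D\<^esub> s)) X)"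
    using D.Comp_Hom[OF ntrans_Hom[OF s X]] ntrans_Hom[OF t X] st X by simp
qed (use ntrans_functors s t in auto)

lemma ntrans_Ident:
  assumes T: "is_functor C D T"
  shows "is_ntrans C D (Ident (functor_cat C D) T)"
proof (rule C.ntransI)
  fix X Y f assume X: "X \<in> Obj C" and Y: "Y \<in> Obj C" and f: "f \<in> Hom C X Y"
  show "farr (ntgt (Ident (functor_cat C D) T)) f \<cdot>\<^bsub>D\<^esub> ncmp (Ident (functor_cat C D) T) X =
    ncmp (Ident (functor_cat C D) T) Y \<cdot>\<^bsub>D\<^esub> farr (nsrc (Ident (functor_cat C D) T)) f"
    using X Y D.Comp_Ident[OF C.functor_Hom[OF T f]] D.Ident_Comp[OF C.functor_Hom[OF T f]]
    by (simp add: functor_cat_def)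
qed (use T D.Ident_Hom functor_obj[OF T] in \<open>auto simp: functor_cat_def\<close>)

lemma category_functor_cat: "category (functor_cat C D)"
proof
  fix f assume "f \<in> Arr (functor_cat C D)"
  then show "Dom (functor_cat C D) f \<in> Obj (functor_cat C D)"
      "Cod (functor_cat C D) f \<in> Obj (functor_cat C D)"
    using ntrans_functors by auto
next
  fix X assume "X \<in> Obj (functor_cat C D)"
  then show "Ident (functor_cat C D) X \<in> Hom (functor_cat C D) X X"
    using ntrans_Ident by simp (simp add: functor_cat_def)
next
  fix f X Y g Z assume "f \<in> Hom (functor_cat C D) X Y" "g \<in> Hom (functor_cat C D) Y Z"
  then show "g \<cdot>\<^bsub>functor_cat C D\<^esub> f \<in> Hom (functor_cat C D) X Z"
    using ntrans_Comp by simp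
next
  fix f X Y assume f: "f \<in> Hom (functor_cat C D) X Y"
  then have fT: "is_ntrans C D f" and F: "is_functor C D X" "is_functor C D Y"
    using ntrans_functors by auto
  have st: "nsrc (Ident (functor_cat C D) T) = T" "ntgt (Ident (functor_cat C D) T) = T"
    "V \<in> Obj C \<Longrightarrow> ncmp (Ident (functor_cat C D) T) V = Ident D (fobj T V)" for T V
    by (simp_all add: functor_cat_def)
  show "f \<cdot>\<^bsub>functor_cat C D\<^esub> Ident (functor_cat C D) X = f"
    using ntrans_Comp[OF ntrans_Ident[OF F(1)] fT] f D.Comp_Ident[OF ntrans_Hom[OF fT]]
    by (intro ntrans_eqI[of C D]) (auto simp: st)
  show "Ident (functor_cat C D) Y \<cdot>\<^bsub>functor_cat C D\<^esub> f = f"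
    using ntrans_Comp[OF fT ntrans_Ident[OF F(2)]] f D.Ident_Comp[OF ntrans_Hom[OF fT]]
    by (intro ntrans_eqI[of C D]) (auto simp: st)
next
  fix f W X g Y h Z
  assume f: "f \<in> Hom (functor_cat C D) W X" and g: "g \<in> Hom (functor_cat C D) X Y"
    and h: "h \<in> Hom (functor_cat C D) Y Z"
  then show "h \<cdot>\<^bsub>functor_cat C D\<^esub> g \<cdot>\<^bsub>functor_cat C D\<^esub> f =
      h \<cdot>\<^bsub>functor_cat C D\<^esub> (g \<cdot>\<^bsub>functor_cat C D\<^esub> f)"
    by (intro ntrans_eqI[of C D])
      (auto intro!: ntrans_Comp D.Comp_assoc dest: ntrans_Hom)
qed

end

sublocale category_pair \<subseteq> FC: category "functor_cat C D"
  by (rule category_functor_cat)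

section \<open>Zero objects and zero arrows in functor categories\<close>

context category_pair
begin

text \<open>The witness is the constant functor at \<open>Z\<close>. Naturality of any choice of
  components is free, since both sides of each square are arrows into or out of a zero
  object.\<close>

lemma functor_cat_zero_object:
  assumes Z: "is_zero_object D Z"
  defines "T \<equiv> \<lparr>fobj = restrict (\<lambda>_. Z) (Obj C), farr = restrict (\<lambda>_. Ident D Z) (Arr C)\<rparr>"
  shows "is_zero_object (functor_cat C D) T"
proof -
  have ZO: "Z \<in> Obj D" using Z by (simp add: is_zero_object_def)
  have IZ: "Ident D Z \<in> Hom D Z Z" using D.Ident_Hom[OF ZO] .
  have T: "is_functor C D T"
  proof (rule C.functorI)
    fix X assume "X \<in> Obj C"
    then show "farr T (Ident C X) = Ident D (fobj T X)"
      using C.Ident_Hom[of X] by (simp add: T_def Hom_iff)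
  next
    fix X Y W f g assume fg: "f \<in> Hom C X Y" "g \<in> Hom C Y W"
    then show "farr T (g \<cdot>\<^bsub>C\<^esub> f) = farr T g \<cdot>\<^bsub>D\<^esub> farr T f"
      using C.Comp_Hom[OF fg] D.Comp_Ident[OF IZ] by (simp add: T_def Hom_iff)
  next
    fix X Y f assume "f \<in> Hom C X Y"
    then show "farr T f \<in> Hom D (fobj T X) (fobj T Y)"
      using IZ C.Hom_Obj[of f X Y] by (simp add: T_def Hom_iff)
  qed (use ZO in \<open>auto simp: T_def\<close>)
  note uin = D.zero_object_unique(1)[OF Z] and uout = D.zero_object_unique(2)[OF Z]
  have TZ: "fobj T X = Z" if "X \<in> Obj C" for X using that by (simp add: T_def)
  have "\<exists>!f. f \<in> Hom (functor_cat C D) S T" if "is_functor C D S" for S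
  proof (rule ex_ex1I)
    let ?c = "\<lambda>X. SOME f. f \<in> Hom D (fobj S X) Z"
    have c: "?c X \<in> Hom D (fobj S X) Z" if "X \<in> Obj C" for X
     
      by (rule someI_ex[OF D.zero_object_arrows(1)[OF Z functor_obj[OF \<open>is_functor C D S\<close> that]]])
    let ?t = "\<lparr>nsrc = S, ntgt = T, ncmp = restrict ?c (Obj C)\<rparr>"
    have "is_ntrans C D ?t"
    proof (rule C.ntransI)
      fix X Y f assume X: "X \<in> Obj C" and Y: "Y \<in> Obj C" and f: "f \<in> Hom C X Y"
      show "farr (ntgt ?t) f \<cdot>\<^bsub>D\<^esub> ncmp ?t X = ncmp ?t Y \<cdot>\<^bsub>D\<^esub> farr (nsrc ?t) f"
        using uin[OF D.Comp_Hom[OF c[OF X]] D.Comp_Hom[OF C.functor_Hom[OF \<open>is_functor C D S\<close> f] c[OF Y]]]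
          C.functor_Hom[OF T f] X Y by (simp add: TZ)
    qed (use T that c in \<open>auto simp: TZ\<close>)
    then show "\<exists>f. f \<in> Hom (functor_cat C D) S T" by (intro exI[of _ ?t]) simp
  next
    fix s t assume "s \<in> Hom (functor_cat C D) S T" "t \<in> Hom (functor_cat C D) S T"
    then show "s = t"
      using uin[of "ncmp s X" "fobj S X" "ncmp t X" for X] ntrans_Hom[of C D s] ntrans_Hom[of C D t]
      by (intro ntrans_eqI[of C D]) (auto simp: TZ)
  qed
  moreover have "\<exists>!f. f \<in> Hom (functor_cat C D) T S" if "is_functor C D S" for S
  proof (rule ex_ex1I)
    let ?c = "\<lambda>X. SOME f. f \<in> Hom D Z (fobj S X)"
    have c: "?c X \<in> Hom D Z (fobj S X)" if "X \<in> Obj C" for X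
     
      by (rule someI_ex[OF D.zero_object_arrows(2)[OF Z functor_obj[OF \<open>is_functor C D S\<close> that]]])
    let ?t = "\<lparr>nsrc = T, ntgt = S, ncmp = restrict ?c (Obj C)\<rparr>"
    have "is_ntrans C D ?t"
    proof (rule C.ntransI)
      fix X Y f assume X: "X \<in> Obj C" and Y: "Y \<in> Obj C" and f: "f \<in> Hom C X Y"
      show "farr (ntgt ?t) f \<cdot>\<^bsub>D\<^esub> ncmp ?t X = ncmp ?t Y \<cdot>\<^bsub>D\<^esub> farr (nsrc ?t) f"
        using uout[OF D.Comp_Hom[OF c[OF X] C.functor_Hom[OF \<open>is_functor C D S\<close> f]] D.Comp_Hom[OF _ c[OF Y]]]
          C.functor_Hom[OF T f] X Y by (simp add: TZ)
    qed (use T that c in \<open>auto simp: TZ\<close>)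
    then show "\<exists>f. f \<in> Hom (functor_cat C D) T S" by (intro exI[of _ ?t]) simp
  next
    fix s t assume "s \<in> Hom (functor_cat C D) T S" "t \<in> Hom (functor_cat C D) T S"
    then show "s = t"
      using uout[of "ncmp s X" "fobj S X" "ncmp t X" for X] ntrans_Hom[of C D s] ntrans_Hom[of C D t]
      by (intro ntrans_eqI[of C D]) (auto simp: TZ)
  qed
  ultimately show ?thesis using T by (simp add: is_zero_object_def)
qed

text \<open>A zero transformation factors through the constant functor at \<open>Z\<close>, so each
  component factors through \<open>Z\<close>. Conversely, some zero transformation with the source
  and target of \<open>t\<close> exists; its components are zero by the first half, so they equal
  those of \<open>t\<close>. All later vanishing in functor categories is tested this way.\<close>

lemma functor_cat_zero_arrow_iff:
  assumes Z: "is_zero_object D Z" and t: "is_ntrans C D t"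
  shows "is_zero_arrow (functor_cat C D) t \<longleftrightarrow> (\<forall>X\<in>Obj C. is_zero_arrow D (ncmp t X))"
proof -
  obtain T where T: "is_zero_object (functor_cat C D) T" "\<And>X. X \<in> Obj C \<Longrightarrow> fobj T X = Z"
    using functor_cat_zero_object[OF Z] by fastforce
  have TF: "is_functor C D (nsrc t)" "is_functor C D (ntgt t)" using ntrans_functors[OF t] by auto
  have L: "\<forall>X\<in>Obj C. is_zero_arrow D (ncmp s X)"
    if s: "is_zero_arrow (functor_cat C D) s" "is_ntrans C D s" for s
  proof
    fix X assume X: "X \<in> Obj C"
    obtain p q where p: "is_ntrans C D p" "ntgt p = T" and q: "is_ntrans C D q" "nsrc q = T"
      and eq: "s = q \<cdot>\<^bsub>functor_cat C D\<^esub> p"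
      using FC.zero_arrow_through[OF s(1) _ T(1)] s(2) by fastforce
    show "is_zero_arrow D (ncmp s X)"
      using D.zero_arrowI[OF Z] ntrans_Hom[OF p(1) X] ntrans_Hom[OF q(1) X] p(2) q(2) eq T(2) X
      by simp
  qed
  moreover have "is_zero_arrow (functor_cat C D) t" if P: "\<forall>X\<in>Obj C. is_zero_arrow D (ncmp t X)"
  proof -
    obtain z where z: "is_ntrans C D z" "nsrc z = nsrc t" "ntgt z = ntgt t"
        "is_zero_arrow (functor_cat C D) z"
      using FC.ex_zero_arrow[OF T(1)] TF by (metis Hom_functor_cat functor_cat_simps(1))
    have "ncmp z X = ncmp t X" if X: "X \<in> Obj C" for X
      using D.zero_arrow_unique[of "ncmp z X" "ncmp t X"] L[OF z(4,1)] P X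
        ntrans_Hom[OF z(1) X] ntrans_Hom[OF t X] z(2,3) by simp
    then have "z = t" using z t by (intro ntrans_eqI[of C D]) auto
    then show ?thesis using z(4) by simp
  qed
  ultimately show ?thesis using t by blast
qed

end

section \<open>Kernels and cokernels computed pointwise\<close>

context category_pair
begin

lemma mono_pointwise:
  assumes s: "is_ntrans C D s" and mono: "\<And>X. X \<in> Obj C \<Longrightarrow> is_mono D (ncmp s X)"
  shows "is_mono (functor_cat C D) s"
  unfolding is_mono_def
proof (intro conjI ballI impI)
  fix R u v
  assume u: "u \<in> Hom (functor_cat C D) R (Dom (functor_cat C D) s)"
    and v: "v \<in> Hom (functor_cat C D) R (Dom (functor_cat C D) s)"
    and eq: "s \<cdot>\<^bsub>functor_cat C D\<^esub> u = s \<cdot>\<^bsub>functor_cat C D\<^esub> v"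
  have "ncmp u X = ncmp v X" if X: "X \<in> Obj C" for X
    using D.monoD[OF mono[OF X] ntrans_Hom[OF s X], of "ncmp u X" "fobj R X" "ncmp v X"]
      ntrans_Hom[of C D u X] ntrans_Hom[of C D v X] u v X
      arg_cong[OF eq, of "\<lambda>t. ncmp t X"] by simp
  then show "u = v" using u v by (intro ntrans_eqI[of C D]) auto
qed (use s in simp)

lemma epi_pointwise:
  assumes s: "is_ntrans C D s" and epi: "\<And>X. X \<in> Obj C \<Longrightarrow> is_epi D (ncmp s X)"
  shows "is_epi (functor_cat C D) s"
  unfolding is_epi_def
proof (intro conjI ballI impI)
  fix R u v
  assume u: "u \<in> Hom (functor_cat C D) (Cod (functor_cat C D) s) R"
    and v: "v \<in> Hom (functor_cat C D) (Cod (functor_cat C D) s) R"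
    and eq: "u \<cdot>\<^bsub>functor_cat C D\<^esub> s = v \<cdot>\<^bsub>functor_cat C D\<^esub> s"
  have "ncmp u X = ncmp v X" if X: "X \<in> Obj C" for X
    using D.epiD[OF epi[OF X] ntrans_Hom[OF s X], of "ncmp u X" "fobj R X" "ncmp v X"]
      ntrans_Hom[of C D u X] ntrans_Hom[of C D v X] u v X
      arg_cong[OF eq, of "\<lambda>t. ncmp t X"] by simp
  then show "u = v" using u v by (intro ntrans_eqI[of C D]) auto
qed (use s in simp)

text \<open>Since \<open>m Y\<close> is monic, the lift of \<open>farr T f\<close> is unique.
  Identities and composites of lifts are again lifts, so uniqueness forces the functor laws. This
  glues kernels chosen object by object into one functor.\<close>

lemma subfunctor_pointwise:
  assumes T: "is_functor C D T"
    and mono: "\<And>X. X \<in> Obj C \<Longrightarrow> is_mono D (m X)"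
    and m: "\<And>X. X \<in> Obj C \<Longrightarrow> m X \<in> Hom D (K X) (fobj T X)"
    and lift: "\<And>X Y f. f \<in> Hom C X Y \<Longrightarrow>
      \<exists>u\<in>Hom D (K X) (K Y). m Y \<cdot>\<^bsub>D\<^esub> u = farr T f \<cdot>\<^bsub>D\<^esub> m X"
  shows "\<exists>t. is_ntrans C D t \<and> ntgt t = T \<and>
    (\<forall>X\<in>Obj C. ncmp t X = m X \<and> fobj (nsrc t) X = K X)"
proof -
  define u where "u f = (SOME u. u \<in> Hom D (K (Dom C f)) (K (Cod C f)) \<and>
    m (Cod C f) \<cdot>\<^bsub>D\<^esub> u = farr T f \<cdot>\<^bsub>D\<^esub> m (Dom C f))" for f
  have u: "u f \<in> Hom D (K X) (K Y)" "m Y \<cdot>\<^bsub>D\<^esub> u f = farr T f \<cdot>\<^bsub>D\<^esub> m X"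
    if f: "f \<in> Hom C X Y" for f X Y
  proof -
    have "\<exists>u. u \<in> Hom D (K X) (K Y) \<and> m Y \<cdot>\<^bsub>D\<^esub> u = farr T f \<cdot>\<^bsub>D\<^esub> m X"
      using lift[OF f] by blast
    from someI_ex[OF this] show "u f \<in> Hom D (K X) (K Y)"
        "m Y \<cdot>\<^bsub>D\<^esub> u f = farr T f \<cdot>\<^bsub>D\<^esub> m X"
      using f unfolding u_def by (simp_all add: Hom_iff)
  qed
  have cancel: "v = w" if "Y \<in> Obj C" "v \<in> Hom D V (K Y)" "w \<in> Hom D V (K Y)"
      "m Y \<cdot>\<^bsub>D\<^esub> v = m Y \<cdot>\<^bsub>D\<^esub> w" for v w V Y
    using D.monoD[OF mono m] that by blast
  define S where "S = \<lparr>fobj = restrict K (Obj C), farr = restrict u (Arr C)\<rparr>"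
  have S: "is_functor C D S"
  proof (rule C.functorI)
    fix X assume X: "X \<in> Obj C"
    then show "fobj S X \<in> Obj D" using D.Hom_Obj[OF m] by (simp add: S_def)
    note I = C.Ident_Hom[OF X] and KX = conjunct1[OF D.Hom_Obj[OF m[OF X]]]
    have "u (Ident C X) = Ident D (K X)"
      using cancel[OF X u(1)[OF I] D.Ident_Hom[OF KX]] u(2)[OF I]
        functor_Ident[OF T X] D.Comp_Ident[OF m[OF X]] D.Ident_Comp[OF m[OF X]] by simp
    then show "farr S (Ident C X) = Ident D (fobj S X)"
      using X I by (simp add: S_def Hom_iff)
  next
    fix X Y f assume f: "f \<in> Hom C X Y"
    then show "farr S f \<in> Hom D (fobj S X) (fobj S Y)"
      using u(1)[OF f] C.Hom_Obj[OF f] by (simp add: S_def Hom_iff)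
  next
    fix X Y W f g assume f: "f \<in> Hom C X Y" and g: "g \<in> Hom C Y W"
    have O: "X \<in> Obj C" "Y \<in> Obj C" "W \<in> Obj C" using C.Hom_Obj f g by auto
    note gf = C.Comp_Hom[OF f g] and Tf = C.functor_Hom[OF T f] and Tg = C.functor_Hom[OF T g]
    have "m W \<cdot>\<^bsub>D\<^esub> (u g \<cdot>\<^bsub>D\<^esub> u f) = (m W \<cdot>\<^bsub>D\<^esub> u g) \<cdot>\<^bsub>D\<^esub> u f"
      using D.Comp_assoc[OF u(1)[OF f] u(1)[OF g] m[OF O(3)]] by simp
    also have "\<dots> = farr T g \<cdot>\<^bsub>D\<^esub> (farr T f \<cdot>\<^bsub>D\<^esub> m X)"
      using D.Comp_assoc[OF u(1)[OF f] m[OF O(2)] Tg] u(2)[OF g] u(2)[OF f] by simp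
    also have "\<dots> = m W \<cdot>\<^bsub>D\<^esub> u (g \<cdot>\<^bsub>C\<^esub> f)"
      using D.Comp_assoc[OF m[OF O(1)] Tf Tg] C.functor_Comp[OF T f g] u(2)[OF gf] by simp
    finally have "u (g \<cdot>\<^bsub>C\<^esub> f) = u g \<cdot>\<^bsub>D\<^esub> u f"
      using cancel[OF O(3) u(1)[OF gf] D.Comp_Hom[OF u(1)[OF f] u(1)[OF g]]] by simp
    then show "farr S (g \<cdot>\<^bsub>C\<^esub> f) = farr S g \<cdot>\<^bsub>D\<^esub> farr S f"
      using f g gf by (simp add: S_def Hom_iff)
  qed (simp_all add: S_def)
  let ?t = "\<lparr>nsrc = S, ntgt = T, ncmp = restrict m (Obj C)\<rparr>"
  have "is_ntrans C D ?t"
  proof (rule C.ntransI)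
    fix X Y f assume X: "X \<in> Obj C" and Y: "Y \<in> Obj C" and f: "f \<in> Hom C X Y"
    then show "farr (ntgt ?t) f \<cdot>\<^bsub>D\<^esub> ncmp ?t X = ncmp ?t Y \<cdot>\<^bsub>D\<^esub> farr (nsrc ?t) f"
      using u(2)[OF f] by (simp add: S_def Hom_iff)
  qed (use S T m in \<open>auto simp: S_def\<close>)
  then show ?thesis by (intro exI[of _ ?t]) (simp add: S_def)
qed

text \<open>The dual gluing: arrows induced on quotients are unique because \<open>e X\<close> is
  epic, whence the functor laws.\<close>

lemma quotient_functor_pointwise:
  assumes T: "is_functor C D T"
    and epi: "\<And>X. X \<in> Obj C \<Longrightarrow> is_epi D (e X)"
    and e: "\<And>X. X \<in> Obj C \<Longrightarrow> e X \<in> Hom D (fobj T X) (K X)"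
    and lift: "\<And>X Y f. f \<in> Hom C X Y \<Longrightarrow>
      \<exists>u\<in>Hom D (K X) (K Y). u \<cdot>\<^bsub>D\<^esub> e X = e Y \<cdot>\<^bsub>D\<^esub> farr T f"
  shows "\<exists>t. is_ntrans C D t \<and> nsrc t = T \<and>
    (\<forall>X\<in>Obj C. ncmp t X = e X \<and> fobj (ntgt t) X = K X)"
proof -
  define u where "u f = (SOME u. u \<in> Hom D (K (Dom C f)) (K (Cod C f)) \<and>
    u \<cdot>\<^bsub>D\<^esub> e (Dom C f) = e (Cod C f) \<cdot>\<^bsub>D\<^esub> farr T f)" for f
  have u: "u f \<in> Hom D (K X) (K Y)" "u f \<cdot>\<^bsub>D\<^esub> e X = e Y \<cdot>\<^bsub>D\<^esub> farr T f"
    if f: "f \<in> Hom C X Y" for f X Y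
  proof -
    have "\<exists>u. u \<in> Hom D (K X) (K Y) \<and> u \<cdot>\<^bsub>D\<^esub> e X = e Y \<cdot>\<^bsub>D\<^esub> farr T f"
      using lift[OF f] by blast
    from someI_ex[OF this] show "u f \<in> Hom D (K X) (K Y)"
        "u f \<cdot>\<^bsub>D\<^esub> e X = e Y \<cdot>\<^bsub>D\<^esub> farr T f"
      using f unfolding u_def by (simp_all add: Hom_iff)
  qed
  have cancel: "v = w" if "X \<in> Obj C" "v \<in> Hom D (K X) V" "w \<in> Hom D (K X) V"
      "v \<cdot>\<^bsub>D\<^esub> e X = w \<cdot>\<^bsub>D\<^esub> e X" for v w V X
    using D.epiD[OF epi e] that by blast
  define S where "S = \<lparr>fobj = restrict K (Obj C), farr = restrict u (Arr C)\<rparr>"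
  have S: "is_functor C D S"
  proof (rule C.functorI)
    fix X assume X: "X \<in> Obj C"
    then show "fobj S X \<in> Obj D" using D.Hom_Obj[OF e] by (simp add: S_def)
    note I = C.Ident_Hom[OF X] and KX = conjunct2[OF D.Hom_Obj[OF e[OF X]]]
    have "u (Ident C X) = Ident D (K X)"
      using cancel[OF X u(1)[OF I] D.Ident_Hom[OF KX]] u(2)[OF I]
        functor_Ident[OF T X] D.Comp_Ident[OF e[OF X]] D.Ident_Comp[OF e[OF X]] by simp
    then show "farr S (Ident C X) = Ident D (fobj S X)"
      using X I by (simp add: S_def Hom_iff)
  next
    fix X Y f assume f: "f \<in> Hom C X Y"
    then show "farr S f \<in> Hom D (fobj S X) (fobj S Y)"
      using u(1)[OF f] C.Hom_Obj[OF f] by (simp add: S_def Hom_iff)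
  next
    fix X Y W f g assume f: "f \<in> Hom C X Y" and g: "g \<in> Hom C Y W"
    have O: "X \<in> Obj C" "Y \<in> Obj C" "W \<in> Obj C" using C.Hom_Obj f g by auto
    note gf = C.Comp_Hom[OF f g] and Tf = C.functor_Hom[OF T f] and Tg = C.functor_Hom[OF T g]
    have "(u g \<cdot>\<^bsub>D\<^esub> u f) \<cdot>\<^bsub>D\<^esub> e X = u g \<cdot>\<^bsub>D\<^esub> (e Y \<cdot>\<^bsub>D\<^esub> farr T f)"
      using D.Comp_assoc[OF e[OF O(1)] u(1)[OF f] u(1)[OF g]] u(2)[OF f] by simp
    also have "\<dots> = (e W \<cdot>\<^bsub>D\<^esub> farr T g) \<cdot>\<^bsub>D\<^esub> farr T f"
      using D.Comp_assoc[OF Tf e[OF O(2)] u(1)[OF g]] u(2)[OF g] by simp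
    also have "\<dots> = u (g \<cdot>\<^bsub>C\<^esub> f) \<cdot>\<^bsub>D\<^esub> e X"
      using D.Comp_assoc[OF Tf Tg e[OF O(3)]] C.functor_Comp[OF T f g] u(2)[OF gf] by simp
    finally have "u (g \<cdot>\<^bsub>C\<^esub> f) = u g \<cdot>\<^bsub>D\<^esub> u f"
      using cancel[OF O(1) u(1)[OF gf] D.Comp_Hom[OF u(1)[OF f] u(1)[OF g]]] by simp
    then show "farr S (g \<cdot>\<^bsub>C\<^esub> f) = farr S g \<cdot>\<^bsub>D\<^esub> farr S f"
      using f g gf by (simp add: S_def Hom_iff)
  qed (simp_all add: S_def)
  let ?t = "\<lparr>nsrc = T, ntgt = S, ncmp = restrict e (Obj C)\<rparr>"
  have "is_ntrans C D ?t"
  proof (rule C.ntransI)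
    fix X Y f assume X: "X \<in> Obj C" and Y: "Y \<in> Obj C" and f: "f \<in> Hom C X Y"
    then show "farr (ntgt ?t) f \<cdot>\<^bsub>D\<^esub> ncmp ?t X = ncmp ?t Y \<cdot>\<^bsub>D\<^esub> farr (nsrc ?t) f"
      using u(2)[OF f] by (simp add: S_def Hom_iff)
  qed (use S T e in \<open>auto simp: S_def\<close>)
  then show ?thesis by (intro exI[of _ ?t]) (simp add: S_def)
qed

text \<open>Factorizations chosen independently at each object are automatically natural. Composed
  with the mono \<open>ncmp s Y\<close>, both sides of the naturality square become
  \<open>ncmp h Y\<close> after \<open>farr (nsrc h) f\<close>, by naturality of \<open>s\<close>
  and \<open>h\<close>.\<close>

lemma ntrans_lift:
  assumes s: "is_ntrans C D s" and mono: "\<And>X. X \<in> Obj C \<Longrightarrow> is_mono D (ncmp s X)"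
    and h: "is_ntrans C D h" and eq: "ntgt h = ntgt s"
    and lift: "\<And>X. X \<in> Obj C \<Longrightarrow>
      \<exists>u\<in>Hom D (fobj (nsrc h) X) (fobj (nsrc s) X). ncmp s X \<cdot>\<^bsub>D\<^esub> u = ncmp h X"
  shows "\<exists>u\<in>Hom (functor_cat C D) (nsrc h) (nsrc s). s \<cdot>\<^bsub>functor_cat C D\<^esub> u = h"
proof -
  obtain u where u: "\<And>X. X \<in> Obj C \<Longrightarrow> u X \<in> Hom D (fobj (nsrc h) X) (fobj (nsrc s) X)"
    and su: "\<And>X. X \<in> Obj C \<Longrightarrow> ncmp s X \<cdot>\<^bsub>D\<^esub> u X = ncmp h X"
    using lift by metis
  note FH = conjunct1[OF ntrans_functors[OF h]] and FS = conjunct1[OF ntrans_functors[OF s]]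
    and FT = conjunct2[OF ntrans_functors[OF s]]
  let ?t = "\<lparr>nsrc = nsrc h, ntgt = nsrc s, ncmp = restrict u (Obj C)\<rparr>"
  have t: "is_ntrans C D ?t"
  proof (rule C.ntransI)
    fix X Y f assume X: "X \<in> Obj C" and Y: "Y \<in> Obj C" and f: "f \<in> Hom C X Y"
    note sX = ntrans_Hom[OF s X] and sY = ntrans_Hom[OF s Y]
      and Hf = C.functor_Hom[OF FH f] and Sf = C.functor_Hom[OF FS f]
      and Tf = C.functor_Hom[OF FT f]
    have "ncmp s Y \<cdot>\<^bsub>D\<^esub> (farr (nsrc s) f \<cdot>\<^bsub>D\<^esub> u X)
        = (ncmp s Y \<cdot>\<^bsub>D\<^esub> farr (nsrc s) f) \<cdot>\<^bsub>D\<^esub> u X"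
      using D.Comp_assoc[OF u[OF X] Sf sY] by simp
    also have "\<dots> = farr (ntgt s) f \<cdot>\<^bsub>D\<^esub> ncmp h X"
      using C.ntrans_nat[OF s f] D.Comp_assoc[OF u[OF X] sX Tf] su[OF X] by simp
    also have "\<dots> = ncmp s Y \<cdot>\<^bsub>D\<^esub> (u Y \<cdot>\<^bsub>D\<^esub> farr (nsrc h) f)"
      using C.ntrans_nat[OF h f] D.Comp_assoc[OF Hf u[OF Y] sY] su[OF Y] eq by simp
    finally show "farr (ntgt ?t) f \<cdot>\<^bsub>D\<^esub> ncmp ?t X = ncmp ?t Y \<cdot>\<^bsub>D\<^esub> farr (nsrc ?t) f"
      using D.monoD[OF mono[OF Y] sY D.Comp_Hom[OF u[OF X] Sf] D.Comp_Hom[OF Hf u[OF Y]]] X Y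
      by simp
  qed (use FH FS u in auto)
  have "s \<cdot>\<^bsub>functor_cat C D\<^esub> ?t = h"
    using ntrans_Comp[OF t s] h eq su by (intro ntrans_eqI[of C D]) auto
  then show ?thesis using t by (intro bexI[of _ ?t]) auto
qed

text \<open>The dual of the lifting argument: naturality is checked after precomposition with the
  epi \<open>ncmp s X\<close>.\<close>

lemma ntrans_extend:
  assumes s: "is_ntrans C D s" and epi: "\<And>X. X \<in> Obj C \<Longrightarrow> is_epi D (ncmp s X)"
    and h: "is_ntrans C D h" and eq: "nsrc h = nsrc s"
    and lift: "\<And>X. X \<in> Obj C \<Longrightarrow>
      \<exists>u\<in>Hom D (fobj (ntgt s) X) (fobj (ntgt h) X). u \<cdot>\<^bsub>D\<^esub> ncmp s X = ncmp h X"
  shows "\<exists>u\<in>Hom (functor_cat C D) (ntgt s) (ntgt h). u \<cdot>\<^bsub>functor_cat C D\<^esub> s = h"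
proof -
  obtain u where u: "\<And>X. X \<in> Obj C \<Longrightarrow> u X \<in> Hom D (fobj (ntgt s) X) (fobj (ntgt h) X)"
    and su: "\<And>X. X \<in> Obj C \<Longrightarrow> u X \<cdot>\<^bsub>D\<^esub> ncmp s X = ncmp h X"
    using lift by metis
  note FH = conjunct2[OF ntrans_functors[OF h]] and FS = conjunct2[OF ntrans_functors[OF s]]
    and FT = conjunct1[OF ntrans_functors[OF s]]
  let ?t = "\<lparr>nsrc = ntgt s, ntgt = ntgt h, ncmp = restrict u (Obj C)\<rparr>"
  have t: "is_ntrans C D ?t"
  proof (rule C.ntransI)
    fix X Y f assume X: "X \<in> Obj C" and Y: "Y \<in> Obj C" and f: "f \<in> Hom C X Y"
    note sX = ntrans_Hom[OF s X] and sY = ntrans_Hom[OF s Y]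
      and Hf = C.functor_Hom[OF FH f] and Sf = C.functor_Hom[OF FS f]
      and Tf = C.functor_Hom[OF FT f]
    have "(farr (ntgt h) f \<cdot>\<^bsub>D\<^esub> u X) \<cdot>\<^bsub>D\<^esub> ncmp s X
        = farr (ntgt h) f \<cdot>\<^bsub>D\<^esub> ncmp h X"
      using D.Comp_assoc[OF sX u[OF X] Hf] su[OF X] by simp
    also have "\<dots> = (u Y \<cdot>\<^bsub>D\<^esub> ncmp s Y) \<cdot>\<^bsub>D\<^esub> farr (nsrc s) f"
      using C.ntrans_nat[OF h f] su[OF Y] eq by simp
    also have "\<dots> = (u Y \<cdot>\<^bsub>D\<^esub> farr (ntgt s) f) \<cdot>\<^bsub>D\<^esub> ncmp s X"
      using C.ntrans_nat[OF s f] D.Comp_assoc[OF Tf sY u[OF Y]] D.Comp_assoc[OF sX Sf u[OF Y]]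
      by simp
    finally show "farr (ntgt ?t) f \<cdot>\<^bsub>D\<^esub> ncmp ?t X = ncmp ?t Y \<cdot>\<^bsub>D\<^esub> farr (nsrc ?t) f"
      using D.epiD[OF epi[OF X] sX D.Comp_Hom[OF u[OF X] Hf] D.Comp_Hom[OF Sf u[OF Y]]] X Y
      by simp
  qed (use FH FS u in auto)
  have "?t \<cdot>\<^bsub>functor_cat C D\<^esub> s = h"
    using ntrans_Comp[OF s t] h eq su by (intro ntrans_eqI[of C D]) auto
  then show ?thesis using t by (intro bexI[of _ ?t]) auto
qed

text \<open>Componentwise kernels form a functor, and componentwise factorizations through them are
  natural. The second conjunct serves to factor an isolated arrow of \<open>D\<close> at one object,
  where the universal property in the functor category says nothing.\<close>

theorem functor_cat_kernel:
  assumes Z: "is_zero_object D Z" and ker: "\<And>f. f \<in> Arr D \<Longrightarrow> \<exists>m. is_kernel D f m"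
    and t: "is_ntrans C D t"
  shows "\<exists>s. is_kernel (functor_cat C D) t s \<and> (\<forall>X\<in>Obj C. is_kernel D (ncmp t X) (ncmp s X))"
proof -
  note FS = conjunct1[OF ntrans_functors[OF t]] and FT = conjunct2[OF ntrans_functors[OF t]]
  define m where "m X = (SOME m. is_kernel D (ncmp t X) m)" for X
  have m: "is_kernel D (ncmp t X) (m X)" if "X \<in> Obj C" for X
  proof -
    have "ncmp t X \<in> Arr D" using ntrans_Hom[OF t that] by (simp add: Hom_iff)
    then show ?thesis unfolding m_def by (rule someI_ex[OF ker])
  qed
  have mH: "m X \<in> Hom D (Dom D (m X)) (fobj (nsrc t) X)" if "X \<in> Obj C" for X
    using m[OF that] ntrans_Hom[OF t that] by (simp add: is_kernel_def Hom_iff)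
  have mz: "is_zero_arrow D (ncmp t X \<cdot>\<^bsub>D\<^esub> m X)" if "X \<in> Obj C" for X
    using m[OF that] by (simp add: is_kernel_def)
  have "\<exists>u\<in>Hom D (Dom D (m X)) (Dom D (m Y)). m Y \<cdot>\<^bsub>D\<^esub> u = farr (nsrc t) f \<cdot>\<^bsub>D\<^esub> m X"
    if f: "f \<in> Hom C X Y" for f X Y
  proof -
    have X: "X \<in> Obj C" and Y: "Y \<in> Obj C" using C.Hom_Obj[OF f] by auto
    note tX = ntrans_Hom[OF t X] and tY = ntrans_Hom[OF t Y]
      and Sf = C.functor_Hom[OF FS f] and Tf = C.functor_Hom[OF FT f]
    \<comment> \<open>Naturality of \<open>t\<close> exchanges \<open>farr (nsrc t) f\<close> for
      \<open>farr (ntgt t) f\<close> and brings \<open>m X\<close> next to \<open>ncmp t X\<close>,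
      which kills it; hence the arrow lifts through the kernel \<open>m Y\<close>.\<close>
    have "ncmp t Y \<cdot>\<^bsub>D\<^esub> (farr (nsrc t) f \<cdot>\<^bsub>D\<^esub> m X)
        = farr (ntgt t) f \<cdot>\<^bsub>D\<^esub> (ncmp t X \<cdot>\<^bsub>D\<^esub> m X)"
      using D.Comp_assoc[OF mH[OF X] Sf tY] D.Comp_assoc[OF mH[OF X] tX Tf]
        C.ntrans_nat[OF t f] by simp
    then show ?thesis
      using D.kernel_factor[OF m[OF Y] tY D.Comp_Hom[OF mH[OF X] Sf]]
        D.zero_arrow_comp_left[OF mz[OF X] D.Comp_Hom[OF mH[OF X] tX] Tf] by simp
  qed
  then obtain s where s: "is_ntrans C D s" "ntgt s = nsrc t"
      and sm: "\<And>X. X \<in> Obj C \<Longrightarrow> ncmp s X = m X"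
    using subfunctor_pointwise[OF FS, of m "\<lambda>X. Dom D (m X)"] mH D.kernel_mono[OF m] by blast
  have sK: "fobj (nsrc s) X = Dom D (m X)" if "X \<in> Obj C" for X
    using ntrans_Hom[OF s(1) that] sm[OF that] by (simp add: Hom_iff)
  have mono: "is_mono D (ncmp s X)" if "X \<in> Obj C" for X
    using D.kernel_mono[OF m[OF that]] sm[OF that] by simp
  note ts = ntrans_Comp[OF s(1) t s(2)]
  have "is_kernel (functor_cat C D) t s"
    unfolding is_kernel_def
  proof (intro conjI ballI impI)
    show "is_zero_arrow (functor_cat C D) (t \<cdot>\<^bsub>functor_cat C D\<^esub> s)"
      using functor_cat_zero_arrow_iff[OF Z ts] mz sm by simp
  next
    fix h assume h: "h \<in> Arr (functor_cat C D)"
      and z: "Cod (functor_cat C D) h = Dom (functor_cat C D) t \<and>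
        is_zero_arrow (functor_cat C D) (t \<cdot>\<^bsub>functor_cat C D\<^esub> h)"
    have hN: "is_ntrans C D h" and ht: "ntgt h = nsrc t" using h z by auto
    have thz: "is_zero_arrow D (ncmp t X \<cdot>\<^bsub>D\<^esub> ncmp h X)" if "X \<in> Obj C" for X
      using functor_cat_zero_arrow_iff[OF Z ntrans_Comp[OF hN t ht]] z that by simp
    have "\<exists>u\<in>Hom D (fobj (nsrc h) X) (fobj (nsrc s) X). ncmp s X \<cdot>\<^bsub>D\<^esub> u = ncmp h X"
      if X: "X \<in> Obj C" for X
      using D.kernel_factor[OF m[OF X] ntrans_Hom[OF t X] _ thz[OF X]] ntrans_Hom[OF hN X]
        ht sK[OF X] sm[OF X] by simp
    then obtain u where u: "u \<in> Hom (functor_cat C D) (nsrc h) (nsrc s)"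
        "s \<cdot>\<^bsub>functor_cat C D\<^esub> u = h"
      using ntrans_lift[OF s(1) mono hN] ht s(2) by auto
    show "\<exists>!u. u \<in> Hom (functor_cat C D) (Dom (functor_cat C D) h) (Dom (functor_cat C D) s) \<and>
        s \<cdot>\<^bsub>functor_cat C D\<^esub> u = h"
    proof (rule ex1I[of _ u])
      fix v assume "v \<in> Hom (functor_cat C D) (Dom (functor_cat C D) h) (Dom (functor_cat C D) s) \<and>
        s \<cdot>\<^bsub>functor_cat C D\<^esub> v = h"
      then show "v = u"
        using FC.monoD[OF mono_pointwise[OF s(1) mono], of "nsrc s" "ntgt s" v "nsrc h" u] u s(1)
        by simp
    qed (use u in simp)
  qed (use s t in auto)
  then show ?thesis using m sm by auto
qed

text \<open>Dual construction. Existence is what makes \<open>some_cokernel\<close> return a genuine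
  cokernel in the functor category.\<close>

theorem functor_cat_cokernel:
  assumes Z: "is_zero_object D Z" and cok: "\<And>f. f \<in> Arr D \<Longrightarrow> \<exists>e. is_cokernel D f e"
    and t: "is_ntrans C D t"
  shows "\<exists>s. is_cokernel (functor_cat C D) t s"
proof -
  note FS = conjunct1[OF ntrans_functors[OF t]] and FT = conjunct2[OF ntrans_functors[OF t]]
  define e where "e X = (SOME e. is_cokernel D (ncmp t X) e)" for X
  have e: "is_cokernel D (ncmp t X) (e X)" if "X \<in> Obj C" for X
  proof -
    have "ncmp t X \<in> Arr D" using ntrans_Hom[OF t that] by (simp add: Hom_iff)
    then show ?thesis unfolding e_def by (rule someI_ex[OF cok])
  qed
  have eH: "e X \<in> Hom D (fobj (ntgt t) X) (Cod D (e X))" if "X \<in> Obj C" for X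
    using e[OF that] ntrans_Hom[OF t that] by (simp add: is_cokernel_def Hom_iff)
  have ez: "is_zero_arrow D (e X \<cdot>\<^bsub>D\<^esub> ncmp t X)" if "X \<in> Obj C" for X
    using e[OF that] by (simp add: is_cokernel_def)
  have "\<exists>u\<in>Hom D (Cod D (e X)) (Cod D (e Y)). u \<cdot>\<^bsub>D\<^esub> e X = e Y \<cdot>\<^bsub>D\<^esub> farr (ntgt t) f"
    if f: "f \<in> Hom C X Y" for f X Y
  proof -
    have X: "X \<in> Obj C" and Y: "Y \<in> Obj C" using C.Hom_Obj[OF f] by auto
    note tX = ntrans_Hom[OF t X] and tY = ntrans_Hom[OF t Y]
      and Sf = C.functor_Hom[OF FS f] and Tf = C.functor_Hom[OF FT f]
    have "(e Y \<cdot>\<^bsub>D\<^esub> farr (ntgt t) f) \<cdot>\<^bsub>D\<^esub> ncmp t X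
        = (e Y \<cdot>\<^bsub>D\<^esub> ncmp t Y) \<cdot>\<^bsub>D\<^esub> farr (nsrc t) f"
      using D.Comp_assoc[OF tX Tf eH[OF Y]] D.Comp_assoc[OF Sf tY eH[OF Y]]
        C.ntrans_nat[OF t f] by simp
    then show ?thesis
      using D.cokernel_factor[OF e[OF X] tX D.Comp_Hom[OF Tf eH[OF Y]]]
        D.zero_arrow_comp_right[OF ez[OF Y] Sf D.Comp_Hom[OF tY eH[OF Y]]] by simp
  qed
  then obtain s where s: "is_ntrans C D s" "nsrc s = ntgt t"
      and se: "\<And>X. X \<in> Obj C \<Longrightarrow> ncmp s X = e X"
    using quotient_functor_pointwise[OF FT, of e "\<lambda>X. Cod D (e X)"] eH D.cokernel_epi[OF e]
    by blast
  have sK: "fobj (ntgt s) X = Cod D (e X)" if "X \<in> Obj C" for X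
    using ntrans_Hom[OF s(1) that] se[OF that] by (simp add: Hom_iff)
  have epi: "is_epi D (ncmp s X)" if "X \<in> Obj C" for X
    using D.cokernel_epi[OF e[OF that]] se[OF that] by simp
  note st = ntrans_Comp[OF t s(1) s(2)[symmetric]]
  have "is_cokernel (functor_cat C D) t s"
    unfolding is_cokernel_def
  proof (intro conjI ballI impI)
    show "is_zero_arrow (functor_cat C D) (s \<cdot>\<^bsub>functor_cat C D\<^esub> t)"
      using functor_cat_zero_arrow_iff[OF Z st] ez se by simp
  next
    fix h assume h: "h \<in> Arr (functor_cat C D)"
      and z: "Dom (functor_cat C D) h = Cod (functor_cat C D) t \<and>
        is_zero_arrow (functor_cat C D) (h \<cdot>\<^bsub>functor_cat C D\<^esub> t)"
    have hN: "is_ntrans C D h" and ht: "nsrc h = ntgt t" using h z by auto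
    have htz: "is_zero_arrow D (ncmp h X \<cdot>\<^bsub>D\<^esub> ncmp t X)" if "X \<in> Obj C" for X
      using functor_cat_zero_arrow_iff[OF Z ntrans_Comp[OF t hN ht[symmetric]]] z that by simp
    have "\<exists>u\<in>Hom D (fobj (ntgt s) X) (fobj (ntgt h) X). u \<cdot>\<^bsub>D\<^esub> ncmp s X = ncmp h X"
      if X: "X \<in> Obj C" for X
      using D.cokernel_factor[OF e[OF X] ntrans_Hom[OF t X] _ htz[OF X]] ntrans_Hom[OF hN X]
        ht sK[OF X] se[OF X] by simp
    then obtain u where u: "u \<in> Hom (functor_cat C D) (ntgt s) (ntgt h)"
        "u \<cdot>\<^bsub>functor_cat C D\<^esub> s = h"
      using ntrans_extend[OF s(1) epi hN] ht s(2) by auto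
    show "\<exists>!u. u \<in> Hom (functor_cat C D) (Cod (functor_cat C D) s) (Cod (functor_cat C D) h) \<and>
        u \<cdot>\<^bsub>functor_cat C D\<^esub> s = h"
    proof (rule ex1I[of _ u])
      fix v assume "v \<in> Hom (functor_cat C D) (Cod (functor_cat C D) s) (Cod (functor_cat C D) h) \<and>
        v \<cdot>\<^bsub>functor_cat C D\<^esub> s = h"
      then show "v = u"
        using FC.epiD[OF epi_pointwise[OF s(1) epi], of "nsrc s" "ntgt s" v "ntgt h" u] u s(1)
        by simp
    qed (use u in simp)
  qed (use s t in auto)
  then show ?thesis by auto
qed

end

section \<open>Identity functors, composition and whiskering\<close>

lemma id_functor_simps [simp]:
  "X \<in> Obj C \<Longrightarrow> fobj (id_functor C) X = X"
  "f \<in> Arr C \<Longrightarrow> farr (id_functor C) f = f"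
  by (simp_all add: id_functor_def)

lemma (in category) is_functor_id: "is_functor C C (id_functor C)"
proof (rule functorI)
  fix X assume "X \<in> Obj C"
  then show "farr (id_functor C) (Ident C X) = Ident C (fobj (id_functor C) X)"
    using Ident_Hom[of X] by (simp add: Hom_iff)
next
  fix X Y f assume f: "f \<in> Hom C X Y"
  then show "farr (id_functor C) f \<in> Hom C (fobj (id_functor C) X) (fobj (id_functor C) Y)"
    using Hom_Obj[OF f] by (simp add: Hom_iff)
next
  fix X Y Z f g assume "f \<in> Hom C X Y" "g \<in> Hom C Y Z"
  then show "farr (id_functor C) (g \<cdot> f) = farr (id_functor C) g \<cdot> farr (id_functor C) f"
    using Comp_Hom[of f X Y g Z] by (simp add: Hom_iff)
qed (simp_all add: id_functor_def)

lemma comp_functor_simps [simp]: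
  "X \<in> Obj C \<Longrightarrow> fobj (comp_functor C T S) X = fobj T (fobj S X)"
  "f \<in> Arr C \<Longrightarrow> farr (comp_functor C T S) f = farr T (farr S f)"
  by (simp_all add: comp_functor_def compose_def)

lemma functor_Arr: "category C \<Longrightarrow> is_functor C D T \<Longrightarrow> f \<in> Arr C \<Longrightarrow> farr T f \<in> Arr D"
  using category.functor_Hom[of C D T f "Dom C f" "Cod C f"] by (simp add: Hom_iff)

lemma is_functor_comp:
  assumes C: "category C" and D: "category D"
    and S: "is_functor C D S" and T: "is_functor D E T"
  shows "is_functor C E (comp_functor C T S)"
proof (rule category.functorI[OF C])
  fix X assume X: "X \<in> Obj C"
  show "fobj (comp_functor C T S) X \<in> Obj E"
    using X functor_obj[OF T functor_obj[OF S X]] by simp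
  have "Ident C X \<in> Arr C" using category.Ident_Hom[OF C X] by (simp add: Hom_iff)
  then show "farr (comp_functor C T S) (Ident C X) = Ident E (fobj (comp_functor C T S) X)"
    using X functor_Ident[OF S X] functor_Ident[OF T functor_obj[OF S X]] by simp
next
  fix X Y f assume f: "f \<in> Hom C X Y"
  have "f \<in> Arr C" "X \<in> Obj C" "Y \<in> Obj C" using f category.Hom_Obj[OF C f] by (auto simp: Hom_iff)
  then show "farr (comp_functor C T S) f
      \<in> Hom E (fobj (comp_functor C T S) X) (fobj (comp_functor C T S) Y)"
    using category.functor_Hom[OF D T category.functor_Hom[OF C S f]] by simp
next
  fix X Y W f g assume f: "f \<in> Hom C X Y" and g: "g \<in> Hom C Y W"
  have "f \<in> Arr C" "g \<in> Arr C" "g \<cdot>\<^bsub>C\<^esub> f \<in> Arr C"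
    using f g category.Comp_Hom[OF C f g] by (auto simp: Hom_iff)
  then show "farr (comp_functor C T S) (g \<cdot>\<^bsub>C\<^esub> f)
      = farr (comp_functor C T S) g \<cdot>\<^bsub>E\<^esub> farr (comp_functor C T S) f"
    using category.functor_Comp[OF C S f g]
      category.functor_Comp[OF D T category.functor_Hom[OF C S f] category.functor_Hom[OF C S g]]
    by simp
qed (simp_all add: comp_functor_def)

text \<open>Whiskering a subfunctor of the identity yields the target \<open>G 1 F\<close>, whereas
  \<open>\<eta>\<close> ends in \<open>G F\<close>. Both are restricted to the same domain, so they
  are equal as records, and the composites \<open>\<pi> \<cdot> \<eta>\<close> and
  \<open>\<pi> \<cdot> G \<sigma> F\<close> are typed correctly.\<close>

lemma comp_functor_comp_id:
  assumes "category C" "is_functor C D S"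
  shows "comp_functor C (comp_functor D T (id_functor D)) S = comp_functor C T S"
  using functor_obj[OF assms(2)] functor_Arr[OF assms]
  by (auto simp: comp_functor_def compose_def id_functor_def fun_eq_iff)

lemma whisker_simps [simp]:
  "nsrc (whisker C D K t H) = comp_functor C (comp_functor D K (nsrc t)) H"
  "ntgt (whisker C D K t H) = comp_functor C (comp_functor D K (ntgt t)) H"
  "X \<in> Obj C \<Longrightarrow> ncmp (whisker C D K t H) X = farr K (ncmp t (fobj H X))"
  by (simp_all add: whisker_def)

lemma whisker_ntrans:
  assumes C: "category C" and D: "category D" and E: "category E"
    and H: "is_functor C D H" and t: "is_ntrans D E t" and K: "is_functor E E' K"
  shows "is_ntrans C E' (whisker C D K t H)"
proof (rule category.ntransI[OF C])
  note FS = conjunct1[OF ntrans_functors[OF t]] and FT = conjunct2[OF ntrans_functors[OF t]]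
  show "is_functor C E' (nsrc (whisker C D K t H))" "is_functor C E' (ntgt (whisker C D K t H))"
    using is_functor_comp[OF C D H] is_functor_comp[OF D E _ K] FS FT by auto
  show "ncmp (whisker C D K t H) \<in> extensional (Obj C)" by (simp add: whisker_def)
  fix X assume X: "X \<in> Obj C"
  note HX = functor_obj[OF H X]
  show "ncmp (whisker C D K t H) X
      \<in> Hom E' (fobj (nsrc (whisker C D K t H)) X) (fobj (ntgt (whisker C D K t H)) X)"
    using category.functor_Hom[OF E K ntrans_Hom[OF t HX]] X HX by simp
next
  note FS = conjunct1[OF ntrans_functors[OF t]] and FT = conjunct2[OF ntrans_functors[OF t]]
  fix X Y f assume X: "X \<in> Obj C" and Y: "Y \<in> Obj C" and f: "f \<in> Hom C X Y"
  note Hf = category.functor_Hom[OF C H f] and HX = functor_obj[OF H X] and HY = functor_obj[OF H Y]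
  have A: "f \<in> Arr C" "farr H f \<in> Arr D" using f Hf by (auto simp: Hom_iff)
  have "farr K (farr (ntgt t) (farr H f)) \<cdot>\<^bsub>E'\<^esub> farr K (ncmp t (fobj H X))
      = farr K (ncmp t (fobj H Y)) \<cdot>\<^bsub>E'\<^esub> farr K (farr (nsrc t) (farr H f))"
    using category.functor_Comp[OF E K ntrans_Hom[OF t HX] category.functor_Hom[OF D FT Hf]]
      category.functor_Comp[OF E K category.functor_Hom[OF D FS Hf] ntrans_Hom[OF t HY]]
      category.ntrans_nat[OF D t Hf] by simp
  then show "farr (ntgt (whisker C D K t H)) f \<cdot>\<^bsub>E'\<^esub> ncmp (whisker C D K t H) X
      = ncmp (whisker C D K t H) Y \<cdot>\<^bsub>E'\<^esub> farr (nsrc (whisker C D K t H)) f"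
    using X Y A by simp
qed

section \<open>Powers and omega preradicals\<close>

lemma ex_power:
  fixes C :: "('o, 'a) cat" and I :: "'i set"
  assumes C: "category C" and complete: "complete_cat TYPE('u) C"
    and small: "small TYPE('u) I" and M: "M \<in> Obj C"
  shows "\<exists>P p. is_product C I (\<lambda>_. M) P p"
proof -
  obtain e :: "'i \<Rightarrow> 'u" where e: "inj_on e I"
    using small unfolding small_def lesspoll_def lepoll_def by auto
  \<comment> \<open>Arrows are identified with their objects. Composable arrows coincide, so a
    composition returning its second argument is correct.\<close>
  define J :: "('u, 'u) cat" where
    "J = \<lparr>Obj = e ` I, Arr = e ` I, Dom = id, Cod = id, Ident = id, Comp = (\<lambda>x y. y)\<rparr>"
  have HJ: "f \<in> Hom J i j \<longleftrightarrow> f = i \<and> f = j \<and> f \<in> e ` I" for f i j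
    by (auto simp: J_def Hom_iff)
  have J: "category J" by unfold_locales (auto simp: HJ, auto simp: J_def)
  have "e ` I \<approx> I" using inj_on_image_eqpoll_self[OF e] by blast
  then have sJ: "small TYPE('u) (Arr J)"
    using small unfolding small_def J_def by (auto intro: eq_lesspoll_trans)
  define T where
    "T = \<lparr>fobj = restrict (\<lambda>_. M) (e ` I), farr = restrict (\<lambda>_. Ident C M) (e ` I)\<rparr>"
  have IM: "Ident C M \<in> Hom C M M" using category.Ident_Hom[OF C M] .
  have ObjJ: "Obj J = e ` I" "Arr J = e ` I" "Ident J x = x" "y \<cdot>\<^bsub>J\<^esub> x = x" for x y
    by (simp_all add: J_def)
  have T: "is_functor J C T"
  proof (rule category.functorI[OF J])
    fix X Y Z f g assume "f \<in> Hom J X Y" "g \<in> Hom J Y Z"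
    then show "farr T (g \<cdot>\<^bsub>J\<^esub> f) = farr T g \<cdot>\<^bsub>C\<^esub> farr T f"
      using category.Comp_Ident[OF C IM] by (auto simp: HJ ObjJ T_def)
  qed (auto simp: HJ ObjJ T_def M IM)
  obtain L p where L: "is_limit J C T L p"
    using complete J sJ T unfolding complete_cat_def by blast
  \<comment> \<open>The only arrows of \<open>J\<close> are identities, so compatibility of a cone
    holds by the identity law and a cone is an arbitrary family.\<close>
  have cone: "is_cone J C T Q q \<longleftrightarrow> Q \<in> Obj C \<and> (\<forall>i\<in>I. q (e i) \<in> Hom C Q M)" for Q q
    using category.Ident_Comp[OF C] by (auto simp: is_cone_def HJ ObjJ T_def)
  have "is_product C I (\<lambda>_. M) L (\<lambda>i. p (e i))"
    unfolding is_product_def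
  proof (intro conjI ballI allI impI)
    show "L \<in> Obj C" "\<And>i. i \<in> I \<Longrightarrow> p (e i) \<in> Hom C L M"
      using L by (auto simp: is_limit_def cone)
    fix Q q assume Q: "Q \<in> Obj C" and q: "\<forall>i\<in>I. q i \<in> Hom C Q M"
    \<comment> \<open>Families over \<open>I\<close> become families over the image of
      \<open>e\<close> by precomposing with the inverse of \<open>e\<close>.\<close>
    have "is_cone J C T Q (\<lambda>x. q (inv_into I e x))"
      using Q q e by (simp add: cone)
    then have "\<exists>!u. u \<in> Hom C Q L \<and> (\<forall>i\<in>Obj J. p i \<cdot>\<^bsub>C\<^esub> u = q (inv_into I e i))"
      using L by (simp add: is_limit_def)
    then show "\<exists>!u. u \<in> Hom C Q L \<and> (\<forall>i\<in>I. p (e i) \<cdot>\<^bsub>C\<^esub> u = q i)"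
      using e by (simp add: ObjJ)
  qed
  then show ?thesis by blast
qed

text \<open>Existence of the powers is the form in which smallness and completeness enter, so the
  size type \<open>'u\<close> does not appear here. The locale is used in \<open>B\<close> for
  \<open>k\<close> and in \<open>A\<close> for \<open>farr G k\<close>.\<close>

locale omega_setting = category C for C :: "('o, 'a) cat" (structure) +
  fixes N M :: 'o and k :: 'a
  assumes k: "k \<in> Hom C N M"
    and powers: "L \<in> Obj C \<Longrightarrow> \<exists>P p. is_product C (Hom C L N) (\<lambda>_. M) P p"
begin

abbreviation W where "W L \<equiv> power_obj C M (Hom C L N)"
abbreviation proj where "proj L \<equiv> power_proj C M (Hom C L N)"

lemma W_product: "L \<in> Obj C \<Longrightarrow> is_product C (Hom C L N) (\<lambda>_. M) (W L) (proj L)"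
proof -
  assume "L \<in> Obj C"
  then have "\<exists>Pp. is_product C (Hom C L N) (\<lambda>_. M) (fst Pp) (snd Pp)"
    using powers by simp
  from someI_ex[OF this] show ?thesis
    unfolding power_obj_def power_proj_def chosen_power_def .
qed

lemma W_Obj: "L \<in> Obj C \<Longrightarrow> W L \<in> Obj C"
  using W_product by (simp add: is_product_def)

lemma proj_Hom: "f \<in> Hom C L N \<Longrightarrow> proj L f \<in> Hom C (W L) M"
  using W_product Hom_Obj unfolding is_product_def by blast

lemma W_ex1:
  assumes "L \<in> Obj C" "Q \<in> Obj C" "\<And>f. f \<in> Hom C L N \<Longrightarrow> q f \<in> Hom C Q M"
  shows "\<exists>!u. u \<in> Hom C Q (W L) \<and> (\<forall>f\<in>Hom C L N. proj L f \<cdot> u = q f)"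
  using W_product[OF assms(1)] assms(2,3) unfolding is_product_def by blast

text \<open>The projections are jointly monic: \<open>u\<close> and \<open>v\<close> both solve the
  universal problem posed by the components of \<open>v\<close>.\<close>

lemma W_ext:
  assumes L: "L \<in> Obj C" and u: "u \<in> Hom C Q (W L)" and v: "v \<in> Hom C Q (W L)"
    and eq: "\<And>f. f \<in> Hom C L N \<Longrightarrow> proj L f \<cdot> u = proj L f \<cdot> v"
  shows "u = v"
proof -
  have "\<exists>!w. w \<in> Hom C Q (W L) \<and> (\<forall>f\<in>Hom C L N. proj L f \<cdot> w = proj L f \<cdot> v)"
    using W_ex1[OF L, of Q "\<lambda>f. proj L f \<cdot> v"] Hom_Obj[OF u] Comp_Hom[OF v proj_Hom] by blast
  then show ?thesis using u v eq by blast
qed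

lemma power_map:
  assumes g: "g \<in> Hom C L L'"
  shows "power_map C M (Hom C L' N) (Hom C L N) (\<lambda>f. f \<cdot> g) \<in> Hom C (W L) (W L')"
    and "f \<in> Hom C L' N \<Longrightarrow>
      proj L' f \<cdot> power_map C M (Hom C L' N) (Hom C L N) (\<lambda>f. f \<cdot> g) = proj L (f \<cdot> g)"
proof -
  have L: "L \<in> Obj C" "L' \<in> Obj C" using Hom_Obj[OF g] by auto
  have "\<exists>!u. u \<in> Hom C (W L) (W L') \<and> (\<forall>f\<in>Hom C L' N. proj L' f \<cdot> u = proj L (f \<cdot> g))"
    using W_ex1[OF L(2) W_Obj[OF L(1)], of "\<lambda>f. proj L (f \<cdot> g)"] proj_Hom[OF Comp_Hom[OF g]]
    by blast
  from theI'[OF this]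
  show "power_map C M (Hom C L' N) (Hom C L N) (\<lambda>f. f \<cdot> g) \<in> Hom C (W L) (W L')"
    and "f \<in> Hom C L' N \<Longrightarrow>
      proj L' f \<cdot> power_map C M (Hom C L' N) (Hom C L N) (\<lambda>f. f \<cdot> g) = proj L (f \<cdot> g)"
    unfolding power_map_def by auto
qed

lemma omega_functor_simps:
  "L \<in> Obj C \<Longrightarrow> fobj (omega_functor C N M) L = W L"
  "g \<in> Hom C L L' \<Longrightarrow> farr (omega_functor C N M) g =
     power_map C M (Hom C L' N) (Hom C L N) (\<lambda>f. f \<cdot> g)"
  by (auto simp: omega_functor_def Hom_iff)

lemma is_functor_omega: "is_functor C C (omega_functor C N M)"
proof (rule functorI)
  fix X assume X: "X \<in> Obj C"
  then show "fobj (omega_functor C N M) X \<in> Obj C" using W_Obj by (simp add: omega_functor_simps)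
  note I = Ident_Hom[OF X]
  have "power_map C M (Hom C X N) (Hom C X N) (\<lambda>f. f \<cdot> Ident C X) = Ident C (W X)"
  proof (rule W_ext[OF X power_map(1)[OF I] Ident_Hom[OF W_Obj[OF X]]])
    fix f assume f: "f \<in> Hom C X N"
    show "proj X f \<cdot> power_map C M (Hom C X N) (Hom C X N) (\<lambda>f. f \<cdot> Ident C X) =
        proj X f \<cdot> Ident C (W X)"
      using power_map(2)[OF I f] Comp_Ident[OF f] Comp_Ident[OF proj_Hom[OF f]] by simp
  qed
  then show "farr (omega_functor C N M) (Ident C X) = Ident C (fobj (omega_functor C N M) X)"
    using X omega_functor_simps(2)[OF Ident_Hom[OF X]] by (simp add: omega_functor_simps)
next
  fix X Y f assume f: "f \<in> Hom C X Y"
  then show "farr (omega_functor C N M) f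
      \<in> Hom C (fobj (omega_functor C N M) X) (fobj (omega_functor C N M) Y)"
    using power_map(1)[OF f] Hom_Obj[OF f] omega_functor_simps by simp
next
  fix X Y Z f g assume f: "f \<in> Hom C X Y" and g: "g \<in> Hom C Y Z"
  have Z: "Z \<in> Obj C" using Hom_Obj[OF g] by simp
  note gf = Comp_Hom[OF f g]
  have "power_map C M (Hom C Z N) (Hom C X N) (\<lambda>h. h \<cdot> (g \<cdot> f)) =
      power_map C M (Hom C Z N) (Hom C Y N) (\<lambda>f. f \<cdot> g) \<cdot>
      power_map C M (Hom C Y N) (Hom C X N) (\<lambda>h. h \<cdot> f)" (is "?gf = ?g \<cdot> ?f")
  proof (rule W_ext[OF Z power_map(1)[OF gf] Comp_Hom[OF power_map(1)[OF f] power_map(1)[OF g]]])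
    fix h assume h: "h \<in> Hom C Z N"
    have "proj Z h \<cdot> (?g \<cdot> ?f) = (proj Z h \<cdot> ?g) \<cdot> ?f"
      using Comp_assoc[OF power_map(1)[OF f] power_map(1)[OF g] proj_Hom[OF h]] by simp
    also have "\<dots> = proj X ((h \<cdot> g) \<cdot> f)"
      using power_map(2)[OF g h] power_map(2)[OF f Comp_Hom[OF g h]] by simp
    finally show "proj Z h \<cdot> ?gf = proj Z h \<cdot> (?g \<cdot> ?f)"
      using power_map(2)[OF gf h] Comp_assoc[OF f g h] by simp
  qed
  then show "farr (omega_functor C N M) (g \<cdot> f) =
      farr (omega_functor C N M) g \<cdot> farr (omega_functor C N M) f"
    using omega_functor_simps(2) f g gf by simp
qed (simp_all add: omega_functor_def)

lemma omega_trans_simps: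
  "nsrc (omega_trans C k) = id_functor C"
  "ntgt (omega_trans C k) = omega_functor C N M"
  using k by (auto simp: omega_trans_def Hom_iff)

lemma omega_trans_cmp:
  assumes L: "L \<in> Obj C"
  shows "ncmp (omega_trans C k) L \<in> Hom C L (W L)"
    and "f \<in> Hom C L N \<Longrightarrow> proj L f \<cdot> ncmp (omega_trans C k) L = k \<cdot> f"
proof -
  have N: "Dom C k = N" and M: "Cod C k = M" using k by (auto simp: Hom_iff)
  have "\<exists>!u. u \<in> Hom C L (W L) \<and> (\<forall>f\<in>Hom C L N. proj L f \<cdot> u = k \<cdot> f)"
    using W_ex1[OF L L, of "\<lambda>f. k \<cdot> f"] Comp_Hom k by blast
  from theI'[OF this]
  show "ncmp (omega_trans C k) L \<in> Hom C L (W L)"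
    and "f \<in> Hom C L N \<Longrightarrow> proj L f \<cdot> ncmp (omega_trans C k) L = k \<cdot> f"
    using L by (simp_all add: omega_trans_def N M)
qed

text \<open>Both sides of the naturality square have the projection
  \<open>k \<cdot> (f \<cdot> g)\<close> at the index \<open>f\<close>, which suffices because
  projections are jointly monic.\<close>

lemma is_ntrans_omega: "is_ntrans C C (omega_trans C k)"
proof (rule ntransI)
  fix X Y g assume X: "X \<in> Obj C" and Y: "Y \<in> Obj C" and g: "g \<in> Hom C X Y"
  let ?W = "power_map C M (Hom C Y N) (Hom C X N) (\<lambda>f. f \<cdot> g)" and ?w = "ncmp (omega_trans C k)"
  note wX = omega_trans_cmp(1)[OF X] and wY = omega_trans_cmp(1)[OF Y] and Wg = power_map(1)[OF g]
  have "?W \<cdot> ?w X = ?w Y \<cdot> g"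
  proof (rule W_ext[OF Y Comp_Hom[OF wX Wg] Comp_Hom[OF g wY]])
    fix f assume f: "f \<in> Hom C Y N"
    note p = proj_Hom[OF f]
    have "proj Y f \<cdot> (?W \<cdot> ?w X) = k \<cdot> (f \<cdot> g)"
      using Comp_assoc[OF wX Wg p] power_map(2)[OF g f] omega_trans_cmp(2)[OF X Comp_Hom[OF g f]]
      by simp
    then show "proj Y f \<cdot> (?W \<cdot> ?w X) = proj Y f \<cdot> (?w Y \<cdot> g)"
      using Comp_assoc[OF g wY p] omega_trans_cmp(2)[OF Y f] Comp_assoc[OF g f k] by simp
  qed
  then show "farr (ntgt (omega_trans C k)) g \<cdot> ncmp (omega_trans C k) X =
      ncmp (omega_trans C k) Y \<cdot> farr (nsrc (omega_trans C k)) g"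
    using g omega_functor_simps(2)[OF g] by (simp add: omega_trans_simps Hom_iff)
next
  show "ncmp (omega_trans C k) \<in> extensional (Obj C)" by (simp add: omega_trans_def)
  fix X assume "X \<in> Obj C"
  then show "ncmp (omega_trans C k) X
      \<in> Hom C (fobj (nsrc (omega_trans C k)) X) (fobj (ntgt (omega_trans C k)) X)"
    using omega_trans_cmp(1) by (simp add: omega_trans_simps omega_functor_simps)
qed (simp_all add: omega_trans_simps is_functor_id is_functor_omega)

text \<open>This removes the power from the picture: what remains is one condition for each
  \<open>f\<close>, to which the adjunction applies separately. If all projections vanish, the arrow
  has the same projections as a zero arrow and so equals it.\<close>

lemma omega_trans_zero_iff:
  assumes Z: "is_zero_object C Z" and h: "h \<in> Hom C X L"
  shows "is_zero_arrow C (ncmp (omega_trans C k) L \<cdot> h) \<longleftrightarrow>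
    (\<forall>f\<in>Hom C L N. is_zero_arrow C (k \<cdot> (f \<cdot> h)))"
proof -
  have X: "X \<in> Obj C" and L: "L \<in> Obj C" using Hom_Obj[OF h] by auto
  let ?w = "ncmp (omega_trans C k) L"
  note w = omega_trans_cmp(1)[OF L] note wh = Comp_Hom[OF h w]
  have eq: "proj L f \<cdot> (?w \<cdot> h) = k \<cdot> (f \<cdot> h)" if f: "f \<in> Hom C L N" for f
    using Comp_assoc[OF h w proj_Hom[OF f]] Comp_assoc[OF h f k] omega_trans_cmp(2)[OF L f] by simp
  have "is_zero_arrow C (?w \<cdot> h)" if zero: "\<And>f. f \<in> Hom C L N \<Longrightarrow> is_zero_arrow C (k \<cdot> (f \<cdot> h))"
  proof -
    obtain z where z: "z \<in> Hom C X (W L)" "is_zero_arrow C z"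
      using ex_zero_arrow[OF Z X W_Obj[OF L]] by blast
    have "z = ?w \<cdot> h"
    proof (rule W_ext[OF L z(1) wh])
      fix f assume f: "f \<in> Hom C L N"
      show "proj L f \<cdot> z = proj L f \<cdot> (?w \<cdot> h)"
        using zero_arrow_unique[OF zero_arrow_comp_left[OF z(2,1) proj_Hom[OF f]] zero[OF f]
            Comp_Hom[OF z(1) proj_Hom[OF f]] Comp_Hom[OF Comp_Hom[OF h f] k]] eq[OF f] by simp
    qed
    then show ?thesis using z(2) by simp
  qed
  moreover have "is_zero_arrow C (k \<cdot> (f \<cdot> h))" if "is_zero_arrow C (?w \<cdot> h)" "f \<in> Hom C L N" for f
    using zero_arrow_comp_left[OF that(1) wh proj_Hom[OF that(2)]] eq[OF that(2)] by simp
  ultimately show ?thesis by blast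
qed

text \<open>Members of \<open>omega C k\<close> need not be kernels of \<open>omega_trans C k\<close> on the nose, only
  equivalent to one; the pointwise factorization property survives this equivalence.\<close>

lemma omega_properties:
  assumes Z: "is_zero_object C Z" and ker: "\<And>f. f \<in> Arr C \<Longrightarrow> \<exists>m. is_kernel C f m"
  shows "omega C k \<in> Pr C" and "\<exists>t. t \<in> omega C k"
    and "t \<in> omega C k \<Longrightarrow> is_ntrans C C t \<and> ntgt t = id_functor C"
    and "t \<in> omega C k \<Longrightarrow> L \<in> Obj C \<Longrightarrow>
      is_zero_arrow C (ncmp (omega_trans C k) L \<cdot> ncmp t L)"
    and "t \<in> omega C k \<Longrightarrow> h \<in> Hom C X L \<Longrightarrow> is_zero_arrow C (ncmp (omega_trans C k) L \<cdot> h) \<Longrightarrow>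
      \<exists>u\<in>Hom C X (fobj (nsrc t) L). ncmp t L \<cdot> u = h"
proof -
  interpret CC: category_pair C C by unfold_locales
  let ?F = "functor_cat C C" and ?w = "omega_trans C k"
  note w = is_ntrans_omega
  \<comment> \<open>Two kernels are in play: \<open>n\<close> has kernels as components, while
    \<open>m\<close> is the one chosen inside \<open>Ker\<close>, of which only the universal
    property in the functor category is known.\<close>
  obtain n where n: "is_kernel ?F ?w n"
    and nker: "\<And>X. X \<in> Obj C \<Longrightarrow> is_kernel C (ncmp ?w X) (ncmp n X)"
    using CC.functor_cat_kernel[OF Z ker w] by blast
  define m where "m = (SOME m. is_kernel ?F ?w m)"
  have m: "is_kernel ?F ?w m" unfolding m_def using n by (rule someI)
  have om: "omega C k = subobject_of ?F m" by (simp add: omega_def Ker_def m_def)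
  have mono: "is_mono ?F m" using CC.FC.kernel_mono[OF m] .
  have mN: "is_ntrans C C m" "ntgt m = id_functor C"
    using m omega_trans_simps by (auto simp: is_kernel_def)
  have nN: "is_ntrans C C n" "ntgt n = id_functor C"
    using n omega_trans_simps by (auto simp: is_kernel_def)
  show "omega C k \<in> Pr C"
    using mono mN om by (auto simp: Pr_def subobjects_def)
  \<comment> \<open>The identity witnesses that \<open>m\<close> factors through itself, so the
    class of \<open>m\<close> is inhabited and choosing a representative is legitimate.\<close>
  have "Ident ?F (nsrc m) \<in> Hom ?F (nsrc m) (nsrc m)" "m \<cdot>\<^bsub>?F\<^esub> Ident ?F (nsrc m) = m"
    using CC.FC.Ident_Hom[of "nsrc m"] CC.FC.Comp_Ident[of m "nsrc m" "ntgt m"]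
      ntrans_functors[OF mN(1)] mN by auto
  then have "m \<in> omega C k"
    unfolding om subobject_of_def factors_through_def using mono by force
  then show "\<exists>t. t \<in> omega C k" by blast
  assume t: "t \<in> omega C k"
  show tN: "is_ntrans C C t \<and> ntgt t = id_functor C"
    using t mN by (auto simp: om subobject_of_def is_mono_def)
  {
    assume L: "L \<in> Obj C"
    obtain u where u: "is_ntrans C C u" "nsrc u = nsrc t" "ntgt u = nsrc m" "t = m \<cdot>\<^bsub>?F\<^esub> u"
      using t by (auto simp: om subobject_of_def factors_through_def)
    note wm = CC.ntrans_Comp[OF mN(1) w]
    have "is_zero_arrow ?F (?w \<cdot>\<^bsub>?F\<^esub> m)" using m by (simp add: is_kernel_def)
    then have z: "is_zero_arrow C (ncmp ?w L \<cdot> ncmp m L)"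
      using CC.functor_cat_zero_arrow_iff[OF Z wm] mN L omega_trans_simps by simp
    have uL: "ncmp u L \<in> Hom C (fobj (nsrc t) L) (fobj (nsrc m) L)"
      using ntrans_Hom[OF u(1) L] u(2,3) by simp
    have mL: "ncmp m L \<in> Hom C (fobj (nsrc m) L) L"
      using ntrans_Hom[OF mN(1) L] mN L by simp
    show "is_zero_arrow C (ncmp ?w L \<cdot> ncmp t L)"
      using zero_arrow_comp_right[OF z uL Comp_Hom[OF mL omega_trans_cmp(1)[OF L]]]
        Comp_assoc[OF uL mL omega_trans_cmp(1)[OF L]] u(4) L by simp
  }
  assume h: "h \<in> Hom C X L" and z: "is_zero_arrow C (ncmp ?w L \<cdot> h)"
  have L: "L \<in> Obj C" using Hom_Obj[OF h] by simp
  have nD: "Dom C (ncmp n L) = fobj (nsrc n) L" using ntrans_Hom[OF nN(1) L] by (simp add: Hom_iff)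
  obtain v where v: "v \<in> Hom C X (fobj (nsrc n) L)" "ncmp n L \<cdot> v = h"
    using kernel_factor[OF nker[OF L] omega_trans_cmp(1)[OF L] h z] nD by auto
  \<comment> \<open>The lift \<open>v\<close> ends in the source of \<open>n\<close>. It is
    transported to the source of \<open>t\<close> along \<open>a\<close>, by which \<open>n\<close>
    factors through \<open>m\<close>, and \<open>b\<close>, by which \<open>m\<close> factors
    through \<open>t\<close>.\<close>
  have "is_zero_arrow ?F (?w \<cdot>\<^bsub>?F\<^esub> n)" using n by (simp add: is_kernel_def)
  then obtain a where a: "is_ntrans C C a" "nsrc a = nsrc n" "ntgt a = nsrc m" "m \<cdot>\<^bsub>?F\<^esub> a = n"
    using CC.FC.kernel_factor[OF m, of "nsrc ?w" "ntgt ?w" n "nsrc n"] w nN omega_trans_simps by auto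
  obtain b where b: "is_ntrans C C b" "nsrc b = nsrc m" "ntgt b = nsrc t" "m = t \<cdot>\<^bsub>?F\<^esub> b"
    using t by (auto simp: om subobject_of_def factors_through_def)
  have aL: "ncmp a L \<in> Hom C (fobj (nsrc n) L) (fobj (nsrc m) L)"
    and bL: "ncmp b L \<in> Hom C (fobj (nsrc m) L) (fobj (nsrc t) L)"
    and tL: "ncmp t L \<in> Hom C (fobj (nsrc t) L) L"
    using ntrans_Hom[OF a(1) L] ntrans_Hom[OF b(1) L] ntrans_Hom[OF conjunct1[OF tN] L]
      a(2,3) b(2,3) tN L by simp_all
  have "ncmp n L = (ncmp t L \<cdot> ncmp b L) \<cdot> ncmp a L"
    using arg_cong[OF a(4), of "\<lambda>s. ncmp s L"] arg_cong[OF b(4), of "\<lambda>s. ncmp s L"] L by simp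
  then have "ncmp t L \<cdot> ((ncmp b L \<cdot> ncmp a L) \<cdot> v) = h"
    using v(2) Comp_assoc[OF aL bL tL] Comp_assoc[OF v(1) Comp_Hom[OF aL bL] tL] by simp
  then show "\<exists>u\<in>Hom C X (fobj (nsrc t) L). ncmp t L \<cdot> u = h"
    using Comp_Hom[OF v(1) Comp_Hom[OF aL bL]] by blast
qed

end

section \<open>Adjoint pairs\<close>

locale adjunction = A: category A + B: category B
  for A :: "('oa, 'aa) cat" and B :: "('ob, 'ab) cat" +
  fixes F :: "('oa, 'aa, 'ob, 'ab) fnctr" and G :: "('ob, 'ab, 'oa, 'aa) fnctr"
    and \<eta> :: "('oa, 'aa, 'oa, 'aa) ntrans" and \<epsilon> :: "('ob, 'ab, 'ob, 'ab) ntrans"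
  assumes adj: "adjoint_pair A B F G \<eta> \<epsilon>"
begin

lemma F: "is_functor A B F" and G: "is_functor B A G"
  and \<eta>: "is_ntrans A A \<eta>" "nsrc \<eta> = id_functor A" "ntgt \<eta> = comp_functor A G F"
  and \<epsilon>: "is_ntrans B B \<epsilon>" "nsrc \<epsilon> = comp_functor B F G" "ntgt \<epsilon> = id_functor B"
  using adj by (auto simp: adjoint_pair_def)

lemma triangle_F: "X \<in> Obj A \<Longrightarrow>
    ncmp \<epsilon> (fobj F X) \<cdot>\<^bsub>B\<^esub> farr F (ncmp \<eta> X) = Ident B (fobj F X)"
  and triangle_G: "Y \<in> Obj B \<Longrightarrow>
    farr G (ncmp \<epsilon> Y) \<cdot>\<^bsub>A\<^esub> ncmp \<eta> (fobj G Y) = Ident A (fobj G Y)"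
  using adj by (auto simp: adjoint_pair_def)

lemma unit_Hom: "X \<in> Obj A \<Longrightarrow> ncmp \<eta> X \<in> Hom A X (fobj G (fobj F X))"
  using ntrans_Hom[OF \<eta>(1), of X] \<eta>(2,3) by simp

lemma counit_Hom: "Y \<in> Obj B \<Longrightarrow> ncmp \<epsilon> Y \<in> Hom B (fobj F (fobj G Y)) Y"
  using ntrans_Hom[OF \<epsilon>(1), of Y] \<epsilon>(2,3) by simp

lemma unit_nat:
  assumes f: "f \<in> Hom A X Y"
  shows "farr G (farr F f) \<cdot>\<^bsub>A\<^esub> ncmp \<eta> X = ncmp \<eta> Y \<cdot>\<^bsub>A\<^esub> f"
proof -
  have "f \<in> Arr A" using f by (simp add: Hom_iff)
  then show ?thesis using A.ntrans_nat[OF \<eta>(1) f] \<eta>(2,3) by simp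
qed

lemma counit_nat:
  assumes f: "f \<in> Hom B X Y"
  shows "f \<cdot>\<^bsub>B\<^esub> ncmp \<epsilon> X = ncmp \<epsilon> Y \<cdot>\<^bsub>B\<^esub> farr F (farr G f)"
proof -
  have "f \<in> Arr B" using f by (simp add: Hom_iff)
  then show ?thesis using B.ntrans_nat[OF \<epsilon>(1) f] \<epsilon>(2,3) by simp
qed

section \<open>Transposition along the adjunction\<close>

lemma transpose_Hom:
  assumes X: "X \<in> Obj A" and u: "u \<in> Hom B (fobj F X) Y"
  shows "farr G u \<cdot>\<^bsub>A\<^esub> ncmp \<eta> X \<in> Hom A X (fobj G Y)"
  using A.Comp_Hom[OF unit_Hom[OF X] B.functor_Hom[OF G u]] .

text \<open>Naturality of \<open>\<epsilon>\<close> moves \<open>u\<close> to the front; what is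
  left behind is the triangle identity at \<open>F X\<close>. Together with its mirror image below,
  this makes transposition a bijection.\<close>

lemma transpose_left:
  assumes X: "X \<in> Obj A" and u: "u \<in> Hom B (fobj F X) Y"
  shows "ncmp \<epsilon> Y \<cdot>\<^bsub>B\<^esub> farr F (farr G u \<cdot>\<^bsub>A\<^esub> ncmp \<eta> X) = u"
proof -
  have FX: "fobj F X \<in> Obj B" and Y: "Y \<in> Obj B" using B.Hom_Obj[OF u] by auto
  note Gu = B.functor_Hom[OF G u]
  note FGu = A.functor_Hom[OF F Gu] and F\<eta> = A.functor_Hom[OF F unit_Hom[OF X]]
  have "ncmp \<epsilon> Y \<cdot>\<^bsub>B\<^esub> farr F (farr G u \<cdot>\<^bsub>A\<^esub> ncmp \<eta> X)
      = (u \<cdot>\<^bsub>B\<^esub> ncmp \<epsilon> (fobj F X)) \<cdot>\<^bsub>B\<^esub> farr F (ncmp \<eta> X)"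
    using A.functor_Comp[OF F unit_Hom[OF X] Gu] B.Comp_assoc[OF F\<eta> FGu counit_Hom[OF Y]]
      counit_nat[OF u] by simp
  then show ?thesis
    using B.Comp_assoc[OF F\<eta> counit_Hom[OF FX] u] triangle_F[OF X] B.Comp_Ident[OF u] by simp
qed

text \<open>Naturality of \<open>\<eta>\<close> moves \<open>v\<close> to the end, leaving the
  triangle identity at \<open>G Y\<close>.\<close>

lemma transpose_right:
  assumes Y: "Y \<in> Obj B" and v: "v \<in> Hom A X (fobj G Y)"
  shows "farr G (ncmp \<epsilon> Y \<cdot>\<^bsub>B\<^esub> farr F v) \<cdot>\<^bsub>A\<^esub> ncmp \<eta> X = v"
proof -
  have X: "X \<in> Obj A" and GY: "fobj G Y \<in> Obj A" using A.Hom_Obj[OF v] by auto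
  note Fv = A.functor_Hom[OF F v]
  note GFv = B.functor_Hom[OF G Fv] and G\<epsilon> = B.functor_Hom[OF G counit_Hom[OF Y]]
  have "farr G (ncmp \<epsilon> Y \<cdot>\<^bsub>B\<^esub> farr F v) \<cdot>\<^bsub>A\<^esub> ncmp \<eta> X
      = farr G (ncmp \<epsilon> Y) \<cdot>\<^bsub>A\<^esub> (ncmp \<eta> (fobj G Y) \<cdot>\<^bsub>A\<^esub> v)"
    using B.functor_Comp[OF G Fv counit_Hom[OF Y]] A.Comp_assoc[OF unit_Hom[OF X] GFv G\<epsilon>]
      unit_nat[OF v] by simp
  then show ?thesis
    using A.Comp_assoc[OF v unit_Hom[OF GY] G\<epsilon>] triangle_G[OF Y] A.Ident_Comp[OF v] by simp
qed

lemma transpose_inject: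
  assumes "X \<in> Obj A" "u \<in> Hom B (fobj F X) Y" "u' \<in> Hom B (fobj F X) Y"
    and "farr G u \<cdot>\<^bsub>A\<^esub> ncmp \<eta> X = farr G u' \<cdot>\<^bsub>A\<^esub> ncmp \<eta> X"
  shows "u = u'"
  using transpose_left[OF assms(1,2)] transpose_left[OF assms(1,3)] assms(4) by metis

text \<open>Arrows into \<open>fobj G Z'\<close> transpose to arrows into the zero object
  \<open>Z'\<close>, so any two with the same source agree. Hence \<open>farr G p\<close> equals a
  zero arrow, and so does anything that factors through it up to composition on the left.\<close>

lemma right_adjoint_zero:
  assumes ZA: "is_zero_object A Z" and ZB: "is_zero_object B Z'"
    and f: "f \<in> Hom B X Y" and zero: "is_zero_arrow B f"
  shows "is_zero_arrow A (farr G f)"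
proof -
  obtain p q where p: "p \<in> Hom B X Z'" and q: "q \<in> Hom B Z' Y" and pq: "f = q \<cdot>\<^bsub>B\<^esub> p"
    using B.zero_arrow_through[OF zero f ZB] by blast
  note Gp = B.functor_Hom[OF G p] and Gq = B.functor_Hom[OF G q]
  have Z': "Z' \<in> Obj B" and O: "fobj G X \<in> Obj A" "fobj G Z' \<in> Obj A"
    using ZB A.Hom_Obj[OF Gp] by (auto simp: is_zero_object_def)
  have terminal: "v = w" if v: "v \<in> Hom A V (fobj G Z')" and w: "w \<in> Hom A V (fobj G Z')" for v w V
  proof -
    have "ncmp \<epsilon> Z' \<cdot>\<^bsub>B\<^esub> farr F v = ncmp \<epsilon> Z' \<cdot>\<^bsub>B\<^esub> farr F w"
      using B.zero_object_unique(1)[OF ZB] B.Comp_Hom counit_Hom[OF Z'] A.functor_Hom[OF F] v w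
      by blast
    then show ?thesis using transpose_right[OF Z' v] transpose_right[OF Z' w] by metis
  qed
  obtain z where "z \<in> Hom A (fobj G X) (fobj G Z')" "is_zero_arrow A z"
    using A.ex_zero_arrow[OF ZA O] by blast
  then have "is_zero_arrow A (farr G p)" using terminal[OF Gp] by simp
  then show ?thesis
    using A.zero_arrow_comp_left[OF _ Gp Gq] B.functor_Comp[OF G p q] pq by simp
qed

text \<open>A zero arrow transposes to a zero arrow because \<open>G\<close> preserves zero arrows.
  The converse follows by injectivity: if the transpose of \<open>u\<close> is zero, it is also the
  transpose of a zero arrow.\<close>

lemma transpose_zero_iff:
  assumes ZA: "is_zero_object A Z" and ZB: "is_zero_object B Z'"
    and X: "X \<in> Obj A" and u: "u \<in> Hom B (fobj F X) Y"
  shows "is_zero_arrow A (farr G u \<cdot>\<^bsub>A\<^esub> ncmp \<eta> X) \<longleftrightarrow> is_zero_arrow B u"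
proof -
  have *: "is_zero_arrow A (farr G v \<cdot>\<^bsub>A\<^esub> ncmp \<eta> X)"
    if "v \<in> Hom B (fobj F X) Y" "is_zero_arrow B v" for v
    using A.zero_arrow_comp_right[OF right_adjoint_zero[OF ZA ZB that] unit_Hom[OF X]
        B.functor_Hom[OF G that(1)]] .
  have "is_zero_arrow B u" if zero: "is_zero_arrow A (farr G u \<cdot>\<^bsub>A\<^esub> ncmp \<eta> X)"
  proof -
    obtain z where z: "z \<in> Hom B (fobj F X) Y" "is_zero_arrow B z"
      using B.ex_zero_arrow[OF ZB] B.Hom_Obj[OF u] by blast
    have "z = u"
      using transpose_inject[OF X z(1) u A.zero_arrow_unique[OF *[OF z] zero
            transpose_Hom[OF X z(1)] transpose_Hom[OF X u]]] .
    then show ?thesis using z(2) by simp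
  qed
  then show ?thesis using *[OF u] by blast
qed

lemma whiskered_transpose:
  assumes v: "v \<in> Hom A X' X" and u: "u \<in> Hom B (fobj F X) Y"
  shows "farr G u \<cdot>\<^bsub>A\<^esub> (ncmp \<eta> X \<cdot>\<^bsub>A\<^esub> v) = farr G (u \<cdot>\<^bsub>B\<^esub> farr F v) \<cdot>\<^bsub>A\<^esub> ncmp \<eta> X'"
proof -
  have X': "X' \<in> Obj A" using A.Hom_Obj[OF v] by simp
  note Fv = A.functor_Hom[OF F v]
  show ?thesis
    using unit_nat[OF v] B.functor_Comp[OF G Fv u]
      A.Comp_assoc[OF unit_Hom[OF X'] B.functor_Hom[OF G Fv] B.functor_Hom[OF G u]] by simp
qed

text \<open>By the criterion on projections, one side tests
  \<open>farr G k \<cdot> (g \<cdot> v)\<close> for all \<open>g : X \<rightarrow> G N\<close>, the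
  other \<open>k \<cdot> (f \<cdot> F v)\<close> for all \<open>f : F X \<rightarrow> N\<close>. If
  \<open>g\<close> is the transpose of \<open>f\<close>, the first arrow is the transpose of the
  second, and transposition preserves and reflects zero arrows.\<close>

lemma omega_trans_transpose_zero_iff:
  assumes ZA: "is_zero_object A Z" and ZB: "is_zero_object B Z'"
    and oA: "omega_setting A (fobj G N) (fobj G M) (farr G k)" and oB: "omega_setting B N M k"
    and v: "v \<in> Hom A X' X"
  shows "is_zero_arrow A (ncmp (omega_trans A (farr G k)) X \<cdot>\<^bsub>A\<^esub> v) \<longleftrightarrow>
    is_zero_arrow B (ncmp (omega_trans B k) (fobj F X) \<cdot>\<^bsub>B\<^esub> farr F v)"
proof -
  have X: "X \<in> Obj A" "X' \<in> Obj A" using A.Hom_Obj[OF v] by auto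
  have k: "k \<in> Hom B N M" using omega_setting.k[OF oB] .
  then have N: "N \<in> Obj B" using B.Hom_Obj by blast
  note Fv = A.functor_Hom[OF F v]
  have zero: "is_zero_arrow A (farr G k \<cdot>\<^bsub>A\<^esub> ((farr G f \<cdot>\<^bsub>A\<^esub> ncmp \<eta> X) \<cdot>\<^bsub>A\<^esub> v)) \<longleftrightarrow>
      is_zero_arrow B (k \<cdot>\<^bsub>B\<^esub> (f \<cdot>\<^bsub>B\<^esub> farr F v))" if f: "f \<in> Hom B (fobj F X) N" for f
  proof -
    note fv = B.Comp_Hom[OF Fv f] and Gk = B.functor_Hom[OF G k] and Gf = B.functor_Hom[OF G f]
    have "farr G k \<cdot>\<^bsub>A\<^esub> ((farr G f \<cdot>\<^bsub>A\<^esub> ncmp \<eta> X) \<cdot>\<^bsub>A\<^esub> v)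
        = farr G k \<cdot>\<^bsub>A\<^esub> (farr G (f \<cdot>\<^bsub>B\<^esub> farr F v) \<cdot>\<^bsub>A\<^esub> ncmp \<eta> X')"
      using A.Comp_assoc[OF v unit_Hom[OF X(1)] Gf] whiskered_transpose[OF v f] by simp
    also have "\<dots> = farr G (k \<cdot>\<^bsub>B\<^esub> (f \<cdot>\<^bsub>B\<^esub> farr F v)) \<cdot>\<^bsub>A\<^esub> ncmp \<eta> X'"
      using A.Comp_assoc[OF unit_Hom[OF X(2)] B.functor_Hom[OF G fv] Gk] B.functor_Comp[OF G fv k]
      by simp
    finally show ?thesis using transpose_zero_iff[OF ZA ZB X(2) B.Comp_Hom[OF fv k]] by simp
  qed
  have "(\<forall>g\<in>Hom A X (fobj G N). is_zero_arrow A (farr G k \<cdot>\<^bsub>A\<^esub> (g \<cdot>\<^bsub>A\<^esub> v))) \<longleftrightarrow>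
      (\<forall>f\<in>Hom B (fobj F X) N. is_zero_arrow B (k \<cdot>\<^bsub>B\<^esub> (f \<cdot>\<^bsub>B\<^esub> farr F v)))"
  proof (intro iffI ballI)
    fix f assume "\<forall>g\<in>Hom A X (fobj G N). is_zero_arrow A (farr G k \<cdot>\<^bsub>A\<^esub> (g \<cdot>\<^bsub>A\<^esub> v))"
      and f: "f \<in> Hom B (fobj F X) N"
    then show "is_zero_arrow B (k \<cdot>\<^bsub>B\<^esub> (f \<cdot>\<^bsub>B\<^esub> farr F v))"
      using transpose_Hom[OF X(1) f] zero[OF f] by blast
  next
    fix g assume *: "\<forall>f\<in>Hom B (fobj F X) N. is_zero_arrow B (k \<cdot>\<^bsub>B\<^esub> (f \<cdot>\<^bsub>B\<^esub> farr F v))"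
      and g: "g \<in> Hom A X (fobj G N)"
    \<comment> \<open>This is the arrow whose transpose is \<open>g\<close>, so the conditions on
      transposes cover every \<open>g\<close>.\<close>
    have f: "ncmp \<epsilon> N \<cdot>\<^bsub>B\<^esub> farr F g \<in> Hom B (fobj F X) N"
      using B.Comp_Hom[OF A.functor_Hom[OF F g] counit_Hom[OF N]] .
    then show "is_zero_arrow A (farr G k \<cdot>\<^bsub>A\<^esub> (g \<cdot>\<^bsub>A\<^esub> v))"
      using zero[OF f] * transpose_right[OF N g] by simp
  qed
  then show ?thesis
    using omega_setting.omega_trans_zero_iff[OF oA ZA v]
      omega_setting.omega_trans_zero_iff[OF oB ZB Fv] by simp
qed

theorem galois_psi_omega:
  assumes ZA: "is_zero_object A Z" and ZB: "is_zero_object B Z'"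
    and cokA: "\<And>f. f \<in> Arr A \<Longrightarrow> \<exists>e. is_cokernel A f e"
    and kerB: "\<And>f. f \<in> Arr B \<Longrightarrow> \<exists>m. is_kernel B f m"
    and oA: "omega_setting A (fobj G N) (fobj G M) (farr G k)" and oB: "omega_setting B N M k"
  shows "galois_psi A B F G \<eta> (omega B k) = omega A (farr G k)"
proof -
  interpret AA: category_pair A A by unfold_locales
  interpret oA: omega_setting A "fobj G N" "fobj G M" "farr G k" by (rule oA)
  interpret oB: omega_setting B N M k by (rule oB)
  let ?A = "functor_cat A A" and ?w = "omega_trans A (farr G k)"
  \<comment> \<open>This is the very representative that \<open>galois_psi\<close> chooses. All that
    is known of it is what holds for each member of \<open>omega B k\<close>.\<close>
  define \<sigma> where "\<sigma> = (SOME t. t \<in> omega B k)"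
  have s\<sigma>: "\<sigma> \<in> omega B k"
    unfolding \<sigma>_def using oB.omega_properties(2)[OF ZB kerB] by (rule someI_ex)
  have \<sigma>: "is_ntrans B B \<sigma>" "ntgt \<sigma> = id_functor B"
    using oB.omega_properties(3)[OF ZB kerB s\<sigma>] by auto
  define t where "t = whisker A B G \<sigma> F"
  have t: "is_ntrans A A t" "ntgt t = comp_functor A G F"
    using whisker_ntrans[OF A.category_axioms B.category_axioms B.category_axioms F \<sigma>(1) G]
      comp_functor_comp_id[OF A.category_axioms F] \<sigma>(2) by (auto simp: t_def)
  define \<pi> where "\<pi> = some_cokernel ?A t"
  have \<pi>: "is_cokernel ?A t \<pi>"
    unfolding \<pi>_def some_cokernel_def
    by (rule someI_ex) (rule AA.functor_cat_cokernel[OF ZA cokA t(1)])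
  have \<pi>N: "is_ntrans A A \<pi>" "nsrc \<pi> = comp_functor A G F"
    using \<pi> t(2) by (auto simp: is_cokernel_def)
  have \<pi>\<eta>: "is_ntrans A A (\<pi> \<cdot>\<^bsub>?A\<^esub> \<eta>)"
    using AA.ntrans_Comp[OF \<eta>(1) \<pi>N(1)] \<eta>(3) \<pi>N(2) by simp
  have psi: "galois_psi A B F G \<eta> (omega B k) = Ker ?A (\<pi> \<cdot>\<^bsub>?A\<^esub> \<eta>)"
    using oB.omega_properties(1)[OF ZB kerB]
    by (simp add: galois_psi_def Let_def \<pi>_def t_def \<sigma>_def)
  have \<sigma>H: "ncmp \<sigma> Y \<in> Hom B (fobj (nsrc \<sigma>) Y) Y" if "Y \<in> Obj B" for Y
    using ntrans_Hom[OF \<sigma>(1) that] \<sigma>(2) that by simp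
  have \<pi>H: "ncmp \<pi> X \<in> Hom A (fobj G (fobj F X)) (fobj (ntgt \<pi>) X)" if "X \<in> Obj A" for X
    using ntrans_Hom[OF \<pi>N(1) that] \<pi>N(2) that by simp
  define W where "W = whisker A B G (omega_trans B k) F"
  have W: "is_ntrans A A W" "nsrc W = comp_functor A G F"
    using whisker_ntrans[OF A.category_axioms B.category_axioms B.category_axioms F
        oB.is_ntrans_omega G] comp_functor_comp_id[OF A.category_axioms F]
    by (auto simp: W_def oB.omega_trans_simps)
  have "is_zero_arrow ?A (W \<cdot>\<^bsub>?A\<^esub> t)"
  proof -
    have "is_zero_arrow A (ncmp (W \<cdot>\<^bsub>?A\<^esub> t) X)" if X: "X \<in> Obj A" for X
    proof -
      note FX = functor_obj[OF F X]
      note w = oB.omega_trans_cmp(1)[OF FX]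
      show ?thesis
        using right_adjoint_zero[OF ZA ZB B.Comp_Hom[OF \<sigma>H[OF FX] w]
            oB.omega_properties(4)[OF ZB kerB s\<sigma> FX]] B.functor_Comp[OF G \<sigma>H[OF FX] w] X
        by (simp add: W_def t_def)
    qed
    then show ?thesis
      using AA.functor_cat_zero_arrow_iff[OF ZA AA.ntrans_Comp[OF t(1) W(1)]] t(2) W(2) by simp
  qed
  then obtain r where r: "is_ntrans A A r" "nsrc r = ntgt \<pi>" "r \<cdot>\<^bsub>?A\<^esub> \<pi> = W"
    using AA.FC.cokernel_factor[OF \<pi>, of "nsrc t" "comp_functor A G F" W "ntgt W"] t W by auto
  have "is_zero_arrow ?A (\<pi> \<cdot>\<^bsub>?A\<^esub> \<eta> \<cdot>\<^bsub>?A\<^esub> h) \<longleftrightarrow> is_zero_arrow ?A (?w \<cdot>\<^bsub>?A\<^esub> h)"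
    if h: "is_ntrans A A h" "ntgt h = id_functor A" for h
  proof -
    have "is_zero_arrow A ((ncmp \<pi> X \<cdot>\<^bsub>A\<^esub> ncmp \<eta> X) \<cdot>\<^bsub>A\<^esub> ncmp h X) \<longleftrightarrow>
        is_zero_arrow A (ncmp ?w X \<cdot>\<^bsub>A\<^esub> ncmp h X)" if X: "X \<in> Obj A" for X
    proof -
      define v where "v = ncmp h X"
      define X' where "X' = fobj (nsrc h) X"
      have v: "v \<in> Hom A X' X"
        using ntrans_Hom[OF h(1) X] h(2) X by (simp add: v_def X'_def)
      have X': "X' \<in> Obj A" using A.Hom_Obj[OF v] by simp
      note FX = functor_obj[OF F X] and Fv = A.functor_Hom[OF F v]
      note w = oB.omega_trans_cmp(1)[OF FX]
      note wv = B.Comp_Hom[OF Fv w] and \<eta>v = A.Comp_Hom[OF v unit_Hom[OF X]]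
        and iff = omega_trans_transpose_zero_iff[OF ZA ZB oA oB v]
      have assoc: "(ncmp \<pi> X \<cdot>\<^bsub>A\<^esub> ncmp \<eta> X) \<cdot>\<^bsub>A\<^esub> v = ncmp \<pi> X \<cdot>\<^bsub>A\<^esub> (ncmp \<eta> X \<cdot>\<^bsub>A\<^esub> v)"
        using A.Comp_assoc[OF v unit_Hom[OF X] \<pi>H[OF X]] .
      have "is_zero_arrow A (ncmp ?w X \<cdot>\<^bsub>A\<^esub> v)"
        if z: "is_zero_arrow A (ncmp \<pi> X \<cdot>\<^bsub>A\<^esub> (ncmp \<eta> X \<cdot>\<^bsub>A\<^esub> v))"
      proof -
        have rX: "ncmp r X \<in> Hom A (fobj (ntgt \<pi>) X) (fobj (ntgt r) X)"
          using ntrans_Hom[OF r(1) X] r(2) by simp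
        have "farr G (ncmp (omega_trans B k) (fobj F X)) = ncmp r X \<cdot>\<^bsub>A\<^esub> ncmp \<pi> X"
          using arg_cong[OF r(3), of "\<lambda>s. ncmp s X"] X by (simp add: W_def)
        then have "farr G (ncmp (omega_trans B k) (fobj F X) \<cdot>\<^bsub>B\<^esub> farr F v) \<cdot>\<^bsub>A\<^esub> ncmp \<eta> X'
            = ncmp r X \<cdot>\<^bsub>A\<^esub> (ncmp \<pi> X \<cdot>\<^bsub>A\<^esub> (ncmp \<eta> X \<cdot>\<^bsub>A\<^esub> v))"
          using whiskered_transpose[OF v w] A.Comp_assoc[OF \<eta>v \<pi>H[OF X] rX] by simp
        then show ?thesis
          using A.zero_arrow_comp_left[OF z A.Comp_Hom[OF \<eta>v \<pi>H[OF X]] rX]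
            transpose_zero_iff[OF ZA ZB X' wv] iff by simp
      qed
      moreover have "is_zero_arrow A (ncmp \<pi> X \<cdot>\<^bsub>A\<^esub> (ncmp \<eta> X \<cdot>\<^bsub>A\<^esub> v))"
        if z: "is_zero_arrow A (ncmp ?w X \<cdot>\<^bsub>A\<^esub> v)"
      proof -
        \<comment> \<open>A factorization at the single object \<open>F X\<close>; naturality in
          \<open>X\<close> is not asked for, since vanishing is tested one component at a
          time.\<close>
        obtain u where u: "u \<in> Hom B (fobj F X') (fobj (nsrc \<sigma>) (fobj F X))"
            "ncmp \<sigma> (fobj F X) \<cdot>\<^bsub>B\<^esub> u = farr F v"
          using oB.omega_properties(5)[OF ZB kerB s\<sigma> Fv] z iff by blast
        note tu = transpose_Hom[OF X' u(1)] and G\<sigma> = B.functor_Hom[OF G \<sigma>H[OF FX]]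
          and Gu = B.functor_Hom[OF G u(1)]
        \<comment> \<open>Naturality of \<open>\<eta>\<close> rewrites the left side as
          \<open>farr G (farr F v) \<cdot> \<eta>\<close> at \<open>X'\<close>; then
          \<open>farr F v\<close> is replaced by its factorization through \<open>\<sigma>\<close>,
          and \<open>G\<close> splits the composite.\<close>
        have "ncmp \<eta> X \<cdot>\<^bsub>A\<^esub> v = farr G (ncmp \<sigma> (fobj F X)) \<cdot>\<^bsub>A\<^esub> (farr G u \<cdot>\<^bsub>A\<^esub> ncmp \<eta> X')"
          using unit_nat[OF v] u(2) B.functor_Comp[OF G u(1) \<sigma>H[OF FX]]
            A.Comp_assoc[OF unit_Hom[OF X'] Gu G\<sigma>] by simp
        then have eq: "ncmp \<pi> X \<cdot>\<^bsub>A\<^esub> (ncmp \<eta> X \<cdot>\<^bsub>A\<^esub> v) =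
            (ncmp \<pi> X \<cdot>\<^bsub>A\<^esub> farr G (ncmp \<sigma> (fobj F X))) \<cdot>\<^bsub>A\<^esub> (farr G u \<cdot>\<^bsub>A\<^esub> ncmp \<eta> X')"
          using A.Comp_assoc[OF tu G\<sigma> \<pi>H[OF X]] by simp
        have "is_zero_arrow ?A (\<pi> \<cdot>\<^bsub>?A\<^esub> t)" using \<pi> by (simp add: is_cokernel_def)
        then have "is_zero_arrow A (ncmp \<pi> X \<cdot>\<^bsub>A\<^esub> farr G (ncmp \<sigma> (fobj F X)))"
          using AA.functor_cat_zero_arrow_iff[OF ZA AA.ntrans_Comp[OF t(1) \<pi>N(1)]] t(2) \<pi>N(2) X
          by (simp add: t_def)
        then show ?thesis
          using A.zero_arrow_comp_right[OF _ tu A.Comp_Hom[OF G\<sigma> \<pi>H[OF X]]] eq by simp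
      qed
      ultimately show ?thesis using assoc unfolding v_def by auto
    qed
    then show ?thesis
      using AA.functor_cat_zero_arrow_iff[OF ZA AA.ntrans_Comp[OF h(1) \<pi>\<eta>]]
        AA.functor_cat_zero_arrow_iff[OF ZA AA.ntrans_Comp[OF h(1) oA.is_ntrans_omega]]
        h(2) \<eta>(2) oA.omega_trans_simps by simp
  qed
  \<comment> \<open>Both arrows have the identity functor as source and annihilate the same
    \<open>h\<close>.\<close>
  then have "Ker ?A (\<pi> \<cdot>\<^bsub>?A\<^esub> \<eta>) = Ker ?A ?w"
    using \<pi>\<eta> oA.is_ntrans_omega \<eta>(2) oA.omega_trans_simps
    by (intro Ker_cong) simp_all
  then show ?thesis using psi by (simp add: omega_def)
qed

end

section \<open>Bicompleteness and small Homs supply the powers\<close>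

lemma omega_settingI:
  assumes "category C" "has_small_Homs TYPE('u) C" "bicomplete TYPE('u) C" "k \<in> Hom C N M"
  shows "omega_setting C N M k"
proof -
  interpret category C by fact
  show ?thesis
  proof
    fix L assume "L \<in> Obj C"
    then show "\<exists>P p. is_product C (Hom C L N) (\<lambda>_. M) P p"
      using ex_power[OF assms(1), where 'u = 'u and I = "Hom C L N" and M = M] assms(2,3)
        Hom_Obj[OF assms(4)] by (simp add: bicomplete_def has_small_Homs_def)
  qed fact
qed

theorem proposition6p13:
  fixes A :: "('oa, 'aa) cat" and B :: "('ob, 'ab) cat"
    and F :: "('oa, 'aa, 'ob, 'ab) fnctr" and G :: "('ob, 'ab, 'oa, 'aa) fnctr"
    and \<eta> :: "('oa, 'aa, 'oa, 'aa) ntrans" and \<epsilon> :: "('ob, 'ab, 'ob, 'ab) ntrans"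
    and \<phi> :: "('oa, 'aa, 'oa, 'aa) ntrans set \<Rightarrow> ('ob, 'ab, 'ob, 'ab) ntrans set"
    and \<psi> :: "('ob, 'ab, 'ob, 'ab) ntrans set \<Rightarrow> ('oa, 'aa, 'oa, 'aa) ntrans set"
    and N M :: 'ob and k :: 'ab
  assumes "abelian A" and "has_small_Homs TYPE('u) A" and "bicomplete TYPE('u) A"
    and "abelian B" and "has_small_Homs TYPE('u) B" and "bicomplete TYPE('u) B"
    and "adjoint_pair A B F G \<eta> \<epsilon>"
    and "(\<phi>, \<psi>) = induced_galois A B F G \<eta> \<epsilon>"
    and "N \<in> Obj B" and "M \<in> Obj B" and "k \<in> Hom B N M"
  shows "\<psi> (omega B k) = omega A (farr G k)"
proof -
  have A: "category A" and B: "category B" using assms(1,4) by (simp_all add: abelian_def)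
  interpret adjunction A B F G \<eta> \<epsilon>
    using A B assms(7) by (simp add: adjunction_def adjunction_axioms_def)
  obtain Z Z' where Z: "is_zero_object A Z" "is_zero_object B Z'"
    using assms(1,4) by (auto simp: abelian_def)
  have "\<psi> = galois_psi A B F G \<eta>" using assms(8) by (simp add: induced_galois_def)
  moreover have "galois_psi A B F G \<eta> (omega B k) = omega A (farr G k)"
  proof (rule galois_psi_omega[OF Z])
    show "omega_setting A (fobj G N) (fobj G M) (farr G k)"
      using omega_settingI[OF A assms(2,3)] B.functor_Hom[OF G assms(11)] by blast
    show "omega_setting B N M k" using omega_settingI[OF B assms(5,6,11)] .
  qed (use assms(1,4) in \<open>simp_all add: abelian_def\<close>)
  ultimately show ?thesis by simp
qed

end
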